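(* The additive group of the quotient ring $\mathbb{Z}\langle X\rangle/T^{(3,2)}$ is free abelian.
   Context: $\mathbb{Z}\langle X\rangle$ is the free unitary associative ring freely generated by the infinite countable set $X=\{x_1,x_2,\dots\}$. Commutators are left-normed: $[a,b]=ab-ba$ and $[a_1,\dots,a_n]=[[a_1,\dots,a_{n-1}],a_n]$. $T^{(3,2)}$ is the two-sided ideal of $\mathbb{Z}\langle X\rangle$ generated by all elements $[a_1,a_2,a_3,a_4]$ and $[a_1,a_2,a_3][a_4,a_5]$ with $a_i\in\mathbb{Z}\langle X\rangle$. *)

theory Defs
  imports "HOL-Algebra.Free_Abelian_Groups" "HOL-Algebra.QuotRing"
    "HOL-Algebra.Algebraic_Closure_Type"
begin

text \<open>
  The free monoid on \<open>'a\<close>, in additive notation as required by the convolution product of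
  \<^theory>\<open>HOL-Library.Poly_Mapping\<close>; the wrapper keeps \<open>list\<close> free of a global \<open>+\<close> instance.
\<close>

datatype 'a fmon = Word (letters: "'a list")

instantiation fmon :: (type) monoid_add
begin

definition zero_fmon :: "'a fmon" where
  "0 = Word []"

definition plus_fmon :: "'a fmon \<Rightarrow> 'a fmon \<Rightarrow> 'a fmon" where
  "u + v = Word (letters u @ letters v)"

instance
  by standard (simp_all add: zero_fmon_def plus_fmon_def)

end

text \<open>
  \<open>\<int>\<langle>X\<rangle>\<close> is the monoid ring over \<open>\<int>\<close> of the free monoid on \<open>X\<close>. The alphabet is \<open>nat\<close>, the
  generator \<open>x\<^sub>i\<close> for \<open>i \<ge> 1\<close> being \<open>Poly_Mapping.single (Word [i - 1]) 1\<close>.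
\<close>

type_synonym free_alg = "nat fmon \<Rightarrow>\<^sub>0 int"

abbreviation ZX :: "free_alg ring" where
  "ZX \<equiv> ring_of_type_algebra"

lemma ring_ring_of_type_algebra: "ring (ring_of_type_algebra :: 'a::ring_1 ring)"
proof -
  have "\<exists>y. x + y = 0" for x :: 'a
    using add.right_inverse by blast
  then show ?thesis
    unfolding ring_of_type_algebra_def using add.right_inverse
    by unfold_locales (auto simp: algebra_simps Units_def)
qed

definition commutator :: "'a::ring \<Rightarrow> 'a \<Rightarrow> 'a" where
  "commutator a b = a * b - b * a"

text \<open>\<open>lcomm [a\<^sub>1, \<dots>, a\<^sub>n]\<close> is the left-normed commutator, for \<open>n \<ge> 1\<close>.\<close>

definition lcomm :: "'a::ring list \<Rightarrow> 'a" where
  "lcomm as = foldl commutator (hd as) (tl as)"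

definition T32 :: "free_alg set" where
  "T32 = genideal ZX
     ({lcomm [a1, a2, a3, a4] | a1 a2 a3 a4. True} \<union>
      {lcomm [a1, a2, a3] * lcomm [a4, a5] | a1 a2 a3 a4 a5. True})"

text \<open>
  Taking the basis \<open>S\<close> from the element type of \<open>G\<close> is no restriction: if \<open>G\<close> is isomorphic to
  the free abelian group on a set in any type, that set embeds into the carrier of \<open>G\<close>.
\<close>

definition free_abelian :: "('a, 'b) monoid_scheme \<Rightarrow> bool" where
  "free_abelian G \<longleftrightarrow> (\<exists>S :: 'a set. G \<cong> free_Abelian_group S)"

end

theory Submission
  imports Defs "HOL-Library.Product_Plus" "HOL-Library.Multiset"
begin

text \<open>
  Write \<open>T\<close> for \<open>T32\<close>. The quotient has an explicit \<open>\<int>\<close>-basis: the classes of the products of a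
  non-decreasing word in the generators with one of the elements
  \<open>1\<close>; \<open>[x\<^sub>i, x\<^sub>j]\<close> with \<open>i < j\<close>; \<open>[x\<^sub>i, x\<^sub>j, x\<^sub>k]\<close> with \<open>i > j \<le> k\<close>; \<open>[x\<^sub>i, x\<^sub>j][x\<^sub>k, x\<^sub>m]\<close> with
  \<open>i < j\<close>, \<open>k < m\<close> and \<open>(i, j) \<le> (k, m)\<close> lexicographically; and products of at least three
  commutators of generators whose letters, read from left to right, increase strictly.

  These elements span. Modulo \<open>T\<close>, triple commutators are central and annihilate all commutators,
  and commutators commute with each other. The identity
  \<open>[a, c][a, b][e, f] = [a, ab, c][e, f] - a[a, b, c][e, f]\<close> puts its left-hand side into \<open>T\<close>, so a
  product of three or more commutators is alternating in its letters (\<open>comm_prod_alternating\<close>) and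
  can be sorted. For two commutators there is no such relation, which is why they are listed
  separately. Multiplying a sorted word by a generator and sorting again costs only corrections that
  contain a double or a triple commutator (\<open>mon_times_gen\<close>), so the span is closed under
  multiplication by generators (\<open>all_spanned\<close>).

  They are independent. The homomorphism \<open>\<Psi>\<close> sends \<open>x\<^sub>i\<close> to \<open>t\<^sub>i + y\<^sub>i + y'\<^sub>i\<close>, where the \<open>t\<^sub>i\<close> are
  central, the \<open>y\<^sub>i\<close> are free, the \<open>y'\<^sub>i\<close> are free, and each \<open>y\<^sub>i\<close> commutes with each \<open>y'\<^sub>j\<close>. Since
  commutators do not see the \<open>t\<^sub>i\<close>, the part of highest \<open>t\<close>-degree of the image of a word times a
  commutator expression \<open>c\<close> is a \<open>t\<close>-monomial times \<open>\<Psi> c\<close> (\<open>coeff_map_top\<close>). It remains to separate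
  the listed expressions \<open>c\<close> by functionals that vanish on \<open>T\<close>. Three truncations of the target
  satisfy the identities that define \<open>T\<close>: no \<open>y'\<close> and \<open>y\<close>-words of length at most \<open>3\<close>, which detects
  \<open>1\<close>, commutators and triple commutators; \<open>y\<close>-words and \<open>y'\<close>-words of length at most \<open>2\<close>, where
  \<open>[x\<^sub>i, x\<^sub>j][x\<^sub>k, x\<^sub>m]\<close> becomes a symmetric tensor (both in \<open>\<Psi>_T32_detectable\<close>); and no \<open>y'\<close> with the
  \<open>y\<^sub>i\<close> as generators of a Grassmann algebra, where triple commutators vanish and \<open>k\<close> commutators
  multiply to \<open>2 ^ k\<close> times a monomial (\<open>grassmann_T32\<close>, \<open>grassmann_comm_prod\<close>). Each basis element
  thus has a functional that is nonzero on it and zero on the others of the same or smaller word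
  length (\<open>dual_functional\<close>), which yields independence.
\<close>

section \<open>Additive subgroups, two-sided ideals and the ideal of the identities\<close>

notation commutator (\<open>\<langle>_,/ _\<rangle>\<close>)

definition add_subgroup :: "'a::ab_group_add set \<Rightarrow> bool" where
  "add_subgroup D \<longleftrightarrow> 0 \<in> D \<and> (\<forall>a\<in>D. \<forall>b\<in>D. a - b \<in> D)"

definition two_sided_ideal :: "'a::ring_1 set \<Rightarrow> bool" where
  "two_sided_ideal I \<longleftrightarrow> add_subgroup I \<and> (\<forall>a\<in>I. \<forall>r. r * a \<in> I \<and> a * r \<in> I)"

lemma add_subgroupD:
  assumes "add_subgroup D"
  shows "0 \<in> D" "a \<in> D \<Longrightarrow> b \<in> D \<Longrightarrow> a - b \<in> D" "a \<in> D \<Longrightarrow> - a \<in> D"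
    "a \<in> D \<Longrightarrow> b \<in> D \<Longrightarrow> a + b \<in> D"
proof -
  have z: "0 \<in> D" and d: "\<And>a b. a \<in> D \<Longrightarrow> b \<in> D \<Longrightarrow> a - b \<in> D"
    using assms by (auto simp: add_subgroup_def)
  show "0 \<in> D" "a \<in> D \<Longrightarrow> b \<in> D \<Longrightarrow> a - b \<in> D" using z d by auto
  show m: "- a \<in> D" if "a \<in> D" for a using d[OF z that] by simp
  show "a \<in> D \<Longrightarrow> b \<in> D \<Longrightarrow> a + b \<in> D" using d[of a "- b"] m by simp
qed

lemma two_sided_idealD:
  assumes "two_sided_ideal I"
  shows "add_subgroup I" "a \<in> I \<Longrightarrow> r * a \<in> I" "a \<in> I \<Longrightarrow> a * r \<in> I"
  using assms by (auto simp: two_sided_ideal_def)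

lemma ideal_ZX_iff: "ideal I ZX \<longleftrightarrow> two_sided_ideal I"
proof
  assume "ideal I ZX"
  then interpret ideal I ZX .
  have d: "a - b \<in> I" if "a \<in> I" "b \<in> I" for a b
  proof -
    have "b * (- 1) \<in> I" using I_r_closed[OF that(2), of "- 1"] by (simp add: ring_of_type_algebra_def)
    then have "- b \<in> I" by simp
    from additive_subgroup.a_closed[OF is_additive_subgroup that(1) this] show ?thesis
      by (simp add: ring_of_type_algebra_def)
  qed
  show "two_sided_ideal I"
    unfolding two_sided_ideal_def add_subgroup_def
    using d additive_subgroup.zero_closed[OF is_additive_subgroup] I_l_closed I_r_closed
    by (auto simp: ring_of_type_algebra_def)
next
  assume I: "two_sided_ideal I"
  note s = add_subgroupD[OF two_sided_idealD(1)[OF I]]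
  interpret ring ZX by (rule ring_ring_of_type_algebra)
  have m: "\<ominus>\<^bsub>ZX\<^esub> b = - b" for b :: free_alg
    by (rule minus_equality) (simp_all add: ring_of_type_algebra_def)
  show "ideal I ZX"
  proof (rule idealI)
    show "ring ZX" by (rule ring_ring_of_type_algebra)
    show "subgroup I (add_monoid ZX)"
      using s m unfolding a_inv_def
      by (intro group.subgroupI[OF a_group]) (auto simp: ring_of_type_algebra_def)
  qed (use two_sided_idealD[OF I] in \<open>auto simp: ring_of_type_algebra_def\<close>)
qed

lemma T32_two_sided: "two_sided_ideal T32"
  and T32_lcomm4: "\<langle>\<langle>\<langle>a, b\<rangle>, c\<rangle>, d\<rangle> \<in> T32"
  and T32_lcomm32: "\<langle>\<langle>a, b\<rangle>, c\<rangle> * \<langle>d, e\<rangle> \<in> T32"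
proof -
  interpret ring ZX by (rule ring_ring_of_type_algebra)
  define G :: "free_alg set" where "G = {lcomm [a1, a2, a3, a4] | a1 a2 a3 a4. True} \<union>
      {lcomm [a1, a2, a3] * lcomm [a4, a5] | a1 a2 a3 a4 a5. True}"
  have G: "G \<subseteq> carrier ZX" by (simp add: ring_of_type_algebra_def)
  show "two_sided_ideal T32"
    using genideal_ideal[OF G] by (simp add: ideal_ZX_iff T32_def G_def)
  have "G \<subseteq> T32" using genideal_self[OF G] by (simp add: T32_def G_def)
  moreover have "\<langle>\<langle>\<langle>a, b\<rangle>, c\<rangle>, d\<rangle> = lcomm [a, b, c, d]"
    "\<langle>\<langle>a, b\<rangle>, c\<rangle> * \<langle>d, e\<rangle> = lcomm [a, b, c] * lcomm [d, e]" by (simp_all add: lcomm_def)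
  ultimately show "\<langle>\<langle>\<langle>a, b\<rangle>, c\<rangle>, d\<rangle> \<in> T32" "\<langle>\<langle>a, b\<rangle>, c\<rangle> * \<langle>d, e\<rangle> \<in> T32"
    unfolding G_def by blast+
qed

text \<open>
  To see that a subset of \<open>\<int>\<langle>X\<rangle>\<close> contains \<open>T32\<close>, it suffices to check this on its generators; this
  is how functionals are shown to vanish on \<open>T32\<close>.
\<close>

lemma T32_least:
  assumes "two_sided_ideal I" "\<And>a b c d. \<langle>\<langle>\<langle>a, b\<rangle>, c\<rangle>, d\<rangle> \<in> I"
    "\<And>a b c d e. \<langle>\<langle>a, b\<rangle>, c\<rangle> * \<langle>d, e\<rangle> \<in> I"
  shows "T32 \<subseteq> I"
proof -
  interpret ring ZX by (rule ring_ring_of_type_algebra)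
  show ?thesis unfolding T32_def
    by (rule genideal_minimal) (use assms in \<open>auto simp: ideal_ZX_iff lcomm_def\<close>)
qed

section \<open>Monoid rings over the integers\<close>

lemma frag_of_mult: "frag_of (u::'k::monoid_add) * frag_of v = frag_of (u + v)"
  by (simp add: mult_single)

lemma commutator_linear:
  "\<langle>a - b, c\<rangle> = \<langle>a, c\<rangle> - \<langle>b, c\<rangle>" "\<langle>c, a - b\<rangle> = \<langle>c, a\<rangle> - \<langle>c, b\<rangle>"
  "\<langle>a + b, c\<rangle> = \<langle>a, c\<rangle> + \<langle>b, c\<rangle>" "\<langle>c, a + b\<rangle> = \<langle>c, a\<rangle> + \<langle>c, b\<rangle>"
  "\<langle>0, c\<rangle> = 0" "\<langle>c, 0\<rangle> = 0"
  by (simp_all add: commutator_def algebra_simps)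

lemma frag_extend_mult:
  fixes g :: "'k::monoid_add \<Rightarrow> 'l::monoid_add \<Rightarrow>\<^sub>0 int"
  assumes "\<And>u v. g (u + v) = g u * g v"
  shows "frag_extend g (a * b) = frag_extend g a * frag_extend g b"
proof -
  have 1: "frag_extend g (frag_of u * b) = g u * frag_extend g b" for u
    by (induction b rule: frag_induction[OF subset_UNIV])
      (simp_all add: frag_of_mult assms frag_extend_diff right_diff_distrib)
  show ?thesis
    by (induction a rule: frag_induction[OF subset_UNIV])
      (simp_all add: 1 frag_extend_diff left_diff_distrib)
qed

definition supported :: "'k set \<Rightarrow> ('k \<Rightarrow>\<^sub>0 int) set" where
  "supported A = {F. Poly_Mapping.keys F \<subseteq> A}"

lemma add_subgroup_supported: "add_subgroup (supported A)"
  unfolding add_subgroup_def supported_def using keys_diff by fastforce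

lemma frag_of_supported [simp]: "frag_of k \<in> supported A \<longleftrightarrow> k \<in> A"
  by (simp add: supported_def)

lemma supported_mono: "A \<subseteq> B \<Longrightarrow> F \<in> supported A \<Longrightarrow> F \<in> supported B"
  by (auto simp: supported_def)

lemma supported_mult:
  fixes F G :: "'k::monoid_add \<Rightarrow>\<^sub>0 int"
  assumes "F \<in> supported A" "G \<in> supported B" "\<And>u v. u \<in> A \<Longrightarrow> v \<in> B \<Longrightarrow> u + v \<in> C"
  shows "F * G \<in> supported C"
  using assms keys_mult[of F G] unfolding supported_def by blast

lemma supported_induct [consumes 1, case_names zero one diff]:
  assumes "F \<in> supported A" "P 0" "\<And>k. k \<in> A \<Longrightarrow> P (frag_of k)"
    "\<And>a b. P a \<Longrightarrow> P b \<Longrightarrow> P (a - b)"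
  shows "P F"
  using frag_induction[of F A P] assms by (auto simp: supported_def)

text \<open>
  Two monomials of a monoid ring have a nonzero commutator only if their exponents do not commute in
  the monoid, so only such pairs have to be inspected. This is where lower bounds on word lengths
  improve: a word of length \<open>0\<close> commutes with everything.
\<close>

lemma supported_commutator:
  fixes F G :: "'k::monoid_add \<Rightarrow>\<^sub>0 int"
  assumes "F \<in> supported A" "G \<in> supported B"
    "\<And>u v. u \<in> A \<Longrightarrow> v \<in> B \<Longrightarrow> u + v \<noteq> v + u \<Longrightarrow> u + v \<in> C \<and> v + u \<in> C"
  shows "\<langle>F, G\<rangle> \<in> supported C"
proof -
  note s = add_subgroupD[OF add_subgroup_supported[of C]]
  have 1: "\<langle>frag_of u, G\<rangle> \<in> supported C" if u: "u \<in> A" for u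
    using assms(2)
  proof (induction rule: supported_induct)
    case zero
    show ?case using s by (simp add: commutator_linear)
  next
    case (one v)
    show ?case using assms(3)[OF u one] s
      by (cases "u + v = v + u") (auto simp: commutator_def frag_of_mult)
  next
    case (diff a b)
    then show ?case using s by (simp add: commutator_linear)
  qed
  show ?thesis using assms(1)
    by (induction rule: supported_induct) (use s 1 in \<open>auto simp: commutator_linear\<close>)
qed

lemma two_sided_ideal_supported:
  fixes A :: "'k::monoid_add set"
  assumes "\<And>u v. u \<in> A \<Longrightarrow> u + v \<in> A \<and> v + u \<in> A"
  shows "two_sided_ideal (supported A)"
  unfolding two_sided_ideal_def
proof (intro conjI ballI allI add_subgroup_supported)
  fix a r :: "'k \<Rightarrow>\<^sub>0 int"
  assume a: "a \<in> supported A"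
  have r: "r \<in> supported UNIV" by (simp add: supported_def)
  show "r * a \<in> supported A" by (rule supported_mult[OF r a]) (use assms in blast)
  show "a * r \<in> supported A" by (rule supported_mult[OF a r]) (use assms in blast)
qed

section \<open>A graded homomorphism and its detectable coefficients\<close>

text \<open>
  The exponents \<open>(m, v, v')\<close> stand for \<open>t\<^sup>m y\<^sub>v y'\<^sub>v\<^sub>'\<close>: a commutative monomial in the \<open>t\<^sub>i\<close> and two
  words, in letters \<open>y\<^sub>i\<close> and \<open>y'\<^sub>i\<close> that commute with each other.
\<close>

type_synonym model = "nat multiset \<times> nat fmon \<times> nat fmon \<Rightarrow>\<^sub>0 int"

abbreviation wlen :: "'a fmon \<Rightarrow> nat" where "wlen w \<equiv> length (letters w)"

lemma letters_simps [simp]: "letters (0::'a fmon) = []" "letters (u + v) = letters u @ letters v"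
  by (simp_all add: zero_fmon_def plus_fmon_def)

lemma letters_Nil_iff [simp]: "letters u = [] \<longleftrightarrow> u = 0"
  by (cases u) (simp add: zero_fmon_def)

lemma Word_plus [simp]: "Word a + Word b = Word (a @ b)"
  by (simp add: plus_fmon_def)

lemma Word_eq_0 [simp]: "Word a = 0 \<longleftrightarrow> a = []" "0 = Word a \<longleftrightarrow> a = []"
  by (auto simp: zero_fmon_def)

lemma fmon_noncommuting: "(u::'a fmon) + v \<noteq> v + u \<Longrightarrow> wlen u \<ge> 1 \<and> wlen v \<ge> 1"
  by (cases u; cases v) (auto simp: Suc_le_eq)

abbreviation mon :: "nat list \<Rightarrow> free_alg" where "mon l \<equiv> frag_of (Word l)"

abbreviation gen :: "nat \<Rightarrow> free_alg" where "gen i \<equiv> mon [i]"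

definition gen_image :: "nat \<Rightarrow> model" where
  "gen_image i = frag_of ({#i#}, 0, 0) + frag_of (0, Word [i], 0) + frag_of (0, 0, Word [i])"

primrec word_image :: "nat list \<Rightarrow> model" where
  "word_image [] = 1"
| "word_image (i # l) = gen_image i * word_image l"

definition \<Psi> :: "free_alg \<Rightarrow> model" where
  "\<Psi> = frag_extend (\<lambda>w. word_image (letters w))"

lemma word_image_append: "word_image (a @ b) = word_image a * word_image b"
  by (induction a) (simp_all add: mult.assoc)

lemma \<Psi>_mult: "\<Psi> (a * b) = \<Psi> a * \<Psi> b"
  unfolding \<Psi>_def by (rule frag_extend_mult) (simp add: word_image_append)

lemma \<Psi>_diff: "\<Psi> (a - b) = \<Psi> a - \<Psi> b"
  by (simp add: \<Psi>_def frag_extend_diff)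

lemma \<Psi>_mon: "\<Psi> (mon l) = word_image l"
  by (simp add: \<Psi>_def)

lemma \<Psi>_0: "\<Psi> 0 = 0"
  by (simp add: \<Psi>_def)

lemma \<Psi>_1: "\<Psi> 1 = 1"
  using \<Psi>_mon[of "[]"] by (simp add: zero_fmon_def[symmetric])

lemma \<Psi>_commutator: "\<Psi> \<langle>a, b\<rangle> = \<langle>\<Psi> a, \<Psi> b\<rangle>"
  by (simp add: commutator_def \<Psi>_diff \<Psi>_mult)

text \<open>
  Since \<open>\<Psi>\<close> maps commutators to commutators, an ideal of the model that contains the generators of
  \<open>T32\<close> formed with arbitrary elements of the model pulls back to an ideal that contains \<open>T32\<close>.
\<close>

lemma \<Psi>_T32:
  assumes K: "two_sided_ideal K" and "\<And>a b c d. \<langle>\<langle>\<langle>a, b\<rangle>, c\<rangle>, d\<rangle> \<in> K"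
    "\<And>a b c d e. \<langle>\<langle>a, b\<rangle>, c\<rangle> * \<langle>d, e\<rangle> \<in> K" and w: "w \<in> T32"
  shows "\<Psi> w \<in> K"
proof -
  have "T32 \<subseteq> {w. \<Psi> w \<in> K}"
    by (rule T32_least)
      (use assms in \<open>auto simp: two_sided_ideal_def add_subgroup_def \<Psi>_0 \<Psi>_diff \<Psi>_mult \<Psi>_commutator\<close>)
  then show ?thesis using w by blast
qed

text \<open>
  The complement of this set is closed under multiplication by arbitrary exponents, hence the
  monomials outside it span an ideal of the model. The set is the union of the two truncations that
  retain triple commutators and products of two commutators.
\<close>

definition detectable :: "(nat multiset \<times> nat fmon \<times> nat fmon) set" where
  "detectable = {(m, v, v'). v' = 0 \<and> wlen v \<le> 3 \<or> wlen v \<le> 2 \<and> wlen v' \<le> 2}"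

text \<open>
  Each commutator raises lengths: \<open>P\<close> contains the exponents of commutators, \<open>Q\<close> those of triple
  commutators. A monomial of \<open>Q\<close> that fails to commute with another one, or is multiplied by one of
  \<open>P\<close>, leaves the detectable range.
\<close>

lemma \<Psi>_T32_detectable:
  assumes "w \<in> T32"
  shows "\<Psi> w \<in> supported (- detectable)"
proof (rule \<Psi>_T32[OF _ _ _ assms])
  define P where "P = {(m::nat multiset, v::nat fmon, v'::nat fmon). wlen v \<ge> 2 \<or> wlen v' \<ge> 2}"
  define Q where "Q = {(m::nat multiset, v::nat fmon, v'::nat fmon).
    wlen v \<ge> 2 \<and> wlen v' \<ge> 2 \<or> wlen v \<ge> 3 \<or> wlen v' \<ge> 3}"
  have detectable: "(m, v, v') \<in> detectable \<longleftrightarrow> wlen v' = 0 \<and> wlen v \<le> 3 \<or> wlen v \<le> 2 \<and> wlen v' \<le> 2" for m v v'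
    by (simp add: detectable_def)
  show "two_sided_ideal (supported (- detectable))"
    by (rule two_sided_ideal_supported) (force simp: detectable)
  \<comment> \<open>The \<open>t\<close>-parts commute, so one of the two word components must fail to.\<close>
  have nc: "(wlen v \<ge> 1 \<and> wlen w \<ge> 1) \<or> (wlen v' \<ge> 1 \<and> wlen w' \<ge> 1)"
    if "(m, v, v') + (n, w, w') \<noteq> (n, w, w') + (m, v, v')" for m n :: "nat multiset" and v w v' w' :: "nat fmon"
    using that fmon_noncommuting[of v w] fmon_noncommuting[of v' w'] by (auto simp: add.commute)
  have P: "\<langle>a, b\<rangle> \<in> supported P" for a b :: model
    by (rule supported_commutator[of _ UNIV _ UNIV])
      (auto dest!: nc simp: supported_def P_def)
  have Q: "\<langle>a, b\<rangle> \<in> supported Q" if "a \<in> supported P" for a b :: model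
    by (rule supported_commutator[OF that, of _ UNIV])
      (auto dest!: nc simp: supported_def P_def Q_def)
  show "\<langle>\<langle>\<langle>a, b\<rangle>, c\<rangle>, d\<rangle> \<in> supported (- detectable)" for a b c d :: model
    by (rule supported_commutator[OF Q[OF P], of _ UNIV])
      (auto dest!: nc simp: supported_def Q_def detectable)
  show "\<langle>\<langle>a, b\<rangle>, c\<rangle> * \<langle>d, e\<rangle> \<in> supported (- detectable)" for a b c d e :: model
    by (rule supported_mult[OF Q[OF P] P]) (auto simp: P_def Q_def detectable)
qed


text \<open>
  Applies a functional of the two words to each coefficient of a polynomial in the \<open>t\<^sub>i\<close>; the result
  is a polynomial in the \<open>t\<^sub>i\<close> with integer coefficients.
\<close>

definition coeff_map :: "(nat fmon \<Rightarrow> nat fmon \<Rightarrow> int) \<Rightarrow> model \<Rightarrow> nat multiset \<Rightarrow>\<^sub>0 int" where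
  "coeff_map \<mu> = frag_extend (\<lambda>(m, v, v'). frag_cmul (\<mu> v v') (frag_of m))"

lemma coeff_map_diff: "coeff_map \<mu> (a - b) = coeff_map \<mu> a - coeff_map \<mu> b"
  and coeff_map_add: "coeff_map \<mu> (a + b) = coeff_map \<mu> a + coeff_map \<mu> b"
  and coeff_map_0: "coeff_map \<mu> 0 = 0"
  and coeff_map_of: "coeff_map \<mu> (frag_of (m, v, v')) = frag_cmul (\<mu> v v') (frag_of m)"
  by (simp_all add: coeff_map_def frag_extend_diff frag_extend_add)

definition indicator_at :: "nat fmon \<Rightarrow> nat fmon \<Rightarrow> nat fmon \<Rightarrow> nat fmon \<Rightarrow> int" where
  "indicator_at a b v v' = (if v = a \<and> v' = b then 1 else 0)"

lemma coeff_map_eq_0: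
  assumes "F \<in> supported A" "\<And>m v v'. (m, v, v') \<in> A \<Longrightarrow> \<mu> v v' = 0"
  shows "coeff_map \<mu> F = 0"
  using assms(1)
  by (induction rule: supported_induct) (auto simp: coeff_map_0 coeff_map_diff coeff_map_of assms(2))

lemma indicator_T32:
  assumes "w \<in> T32" "b = 0 \<and> wlen a \<le> 3 \<or> wlen a \<le> 2 \<and> wlen b \<le> 2"
  shows "coeff_map (indicator_at a b) (\<Psi> w) = 0"
  by (rule coeff_map_eq_0[OF \<Psi>_T32_detectable[OF assms(1)]]) (use assms(2) in \<open>auto simp: detectable_def indicator_at_def\<close>)

section \<open>The Grassmann functional\<close>

primrec inversions :: "nat list \<Rightarrow> nat" where
  "inversions [] = 0"
| "inversions (x # l) = length (filter (\<lambda>y. y < x) l) + inversions l"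

primrec cross_inversions :: "nat list \<Rightarrow> nat list \<Rightarrow> nat" where
  "cross_inversions [] l = 0"
| "cross_inversions (x # k) l = length (filter (\<lambda>y. y < x) l) + cross_inversions k l"

lemma inversions_append: "inversions (a @ b) = inversions a + inversions b + cross_inversions a b"
  by (induction a) simp_all

lemma cross_inversions_append:
  "cross_inversions (a @ b) c = cross_inversions a c + cross_inversions b c"
  "cross_inversions c (a @ b) = cross_inversions c a + cross_inversions c b"
proof -
  show "cross_inversions (a @ b) c = cross_inversions a c + cross_inversions b c" by (induction a) simp_all
  show "cross_inversions c (a @ b) = cross_inversions c a + cross_inversions c b" by (induction c) simp_all
qed

lemma cross_inversions_Nil: "cross_inversions a [] = 0"
  by (induction a) simp_all

lemma cross_inversions_Cons:
  "cross_inversions a (x # b) = length (filter (\<lambda>y. x < y) a) + cross_inversions a b"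
  by (induction a) simp_all

lemma cross_inversions_swap:
  "set a \<inter> set b = {} \<Longrightarrow> cross_inversions a b + cross_inversions b a = length a * length b"
proof (induction a)
  case (Cons x a)
  have "length (filter (\<lambda>y. y < x) b) + length (filter (\<lambda>y. x < y) b) = length b"
    using Cons.prems by (induction b) auto
  then show ?case using Cons by (simp add: cross_inversions_Cons)
qed (simp add: cross_inversions_Nil)

text \<open>
  The coefficient of the increasing product of the letters in \<open>I\<close> in the Grassmann monomial of
  the word \<open>v\<close>.
\<close>

definition signum :: "nat set \<Rightarrow> nat fmon \<Rightarrow> int" where
  "signum I v = (if distinct (letters v) \<and> set (letters v) = I then (-1) ^ inversions (letters v) else 0)"

text \<open>
  Exchanging adjacent blocks \<open>a\<close> and \<open>b\<close> of disjoint words changes only the relative order of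
  letters of \<open>a\<close> and letters of \<open>b\<close>, which are \<open>|a| |b|\<close> pairs.
\<close>

lemma signum_swap: "signum I (p + (a + (b + q))) = (-1) ^ (wlen a * wlen b) * signum I (p + (b + (a + q)))"
proof (cases "distinct (letters (p + (a + (b + q)))) \<and> set (letters (p + (a + (b + q)))) = I")
  case True
  then have "set (letters a) \<inter> set (letters b) = {}" by auto
  from cross_inversions_swap[OF this] have "inversions (letters (p + (a + (b + q)))) + 2 * cross_inversions (letters b) (letters a)
    = wlen a * wlen b + inversions (letters (p + (b + (a + q))))"
    by (simp add: inversions_append cross_inversions_append)
  then have "(-1::int) ^ (inversions (letters (p + (a + (b + q)))) + 2 * cross_inversions (letters b) (letters a))
    = (-1) ^ (wlen a * wlen b + inversions (letters (p + (b + (a + q)))))"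
    by (simp only:)
  then have "(-1::int) ^ inversions (letters (p + (a + (b + q))))
    = (-1) ^ (wlen a * wlen b + inversions (letters (p + (b + (a + q)))))"
    by (simp add: power_add)
  moreover have "distinct (letters (p + (b + (a + q)))) \<and> set (letters (p + (b + (a + q)))) = I"
    using True by auto
  ultimately show ?thesis using True by (simp add: signum_def power_add del: letters_simps)
next
  case False
  then have "\<not> (distinct (letters (p + (b + (a + q)))) \<and> set (letters (p + (b + (a + q)))) = I)"
    by auto
  with False show ?thesis by (simp add: signum_def del: letters_simps)
qed

definition grassmann :: "nat set \<Rightarrow> nat fmon \<Rightarrow> nat fmon \<Rightarrow> int" where
  "grassmann I v v' = (if v' = 0 then signum I v else 0)"

lemma fmon_plus_eq_0_iff [simp]: "(u::'a fmon) + v = 0 \<longleftrightarrow> u = 0 \<and> v = 0"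
  by (metis Nil_is_append_conv letters_Nil_iff letters_simps(2))

text \<open>
  A Grassmann algebra satisfies \<open>[a, b, c] = 0\<close>. For monomials, the four terms carry the signs
  \<open>1, - \<epsilon>, - \<delta>, \<epsilon> \<delta>\<close> relative to one another, where \<open>\<epsilon>\<close> is \<open>- 1\<close> only if \<open>a\<close> and \<open>b\<close> are both odd; but
  then \<open>ab\<close> is even, hence central, and \<open>\<delta> = 1\<close>. The factors \<open>p\<close> and \<open>q\<close> make the statement one about
  the ideal generated by triple commutators.
\<close>

lemma grassmann_lie3:
  "coeff_map (grassmann I) (frag_of p * \<langle>\<langle>a, b\<rangle>, c\<rangle> * frag_of q) = 0"
proof -
  let ?Z = "\<lambda>a b c. coeff_map (grassmann I) (frag_of p * \<langle>\<langle>a, b\<rangle>, c\<rangle> * frag_of q) = 0"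
  have mono: "?Z (frag_of a) (frag_of b) (frag_of c)" for a b c
  proof -
    obtain pm p1 p2 am a1 a2 bm b1 b2 cm c1 c2 qm q1 q2 where
      k: "p = (pm, p1, p2)" "a = (am, a1, a2)" "b = (bm, b1, b2)" "c = (cm, c1, c2)" "q = (qm, q1, q2)"
      by (metis prod_cases3)
    define \<epsilon> :: int where "\<epsilon> = (-1) ^ (wlen a1 * wlen b1)"
    define \<delta> :: int where "\<delta> = (-1) ^ (wlen c1 * (wlen a1 + wlen b1))"
    define s where "s = signum I (p1 + (b1 + (a1 + (c1 + q1))))"
    have s1: "signum I (p1 + (a1 + (b1 + (c1 + q1)))) = \<epsilon> * s"
      using signum_swap[of I p1 a1 b1 "c1 + q1"] by (simp add: \<epsilon>_def s_def)
    have s3: "signum I (p1 + (c1 + (a1 + (b1 + q1)))) = \<delta> * (\<epsilon> * s)"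
      using signum_swap[of I p1 c1 "a1 + b1" q1] s1 by (simp add: \<delta>_def add.assoc)
    have s4: "signum I (p1 + (c1 + (b1 + (a1 + q1)))) = \<delta> * s"
      using signum_swap[of I p1 c1 "b1 + a1" q1] by (simp add: \<delta>_def s_def add.assoc add.commute)
    have "even (wlen a1 * wlen b1) \<or> even (wlen c1 * (wlen a1 + wlen b1))" by auto
    then have "\<epsilon> = 1 \<or> \<delta> = 1" by (auto simp: \<epsilon>_def \<delta>_def)
    then have z: "\<epsilon> * s - s - \<delta> * (\<epsilon> * s) + \<delta> * s = 0" by auto
    have e: "frag_of p * \<langle>\<langle>frag_of a, frag_of b\<rangle>, frag_of c\<rangle> * frag_of q
      = frag_of (p + (a + (b + (c + q)))) - frag_of (p + (b + (a + (c + q))))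
        - frag_of (p + (c + (a + (b + q)))) + frag_of (p + (c + (b + (a + q))))"
      by (simp add: commutator_def algebra_simps mult_single)
    have m: "pm + (bm + (am + (cm + qm))) = pm + (am + (bm + (cm + qm)))"
      "pm + (cm + (am + (bm + qm))) = pm + (am + (bm + (cm + qm)))"
      "pm + (cm + (bm + (am + qm))) = pm + (am + (bm + (cm + qm)))" by (simp_all add: ac_simps)
    show ?thesis
      unfolding e unfolding k using z
      by (simp add: coeff_map_add coeff_map_diff coeff_map_of grassmann_def s1 s3 s4 s_def[symmetric] m
        frag_cmul_distrib[symmetric] frag_cmul_diff_distrib[symmetric])
  qed
  have 1: "?Z (frag_of a) (frag_of b) c" for a b
    by (induction c rule: frag_induction[OF subset_UNIV])
      (simp_all add: mono commutator_linear coeff_map_0 coeff_map_diff right_diff_distrib left_diff_distrib)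
  have 2: "?Z (frag_of a) b c" for a
    by (induction b rule: frag_induction[OF subset_UNIV])
      (simp_all add: 1 commutator_linear coeff_map_0 coeff_map_diff right_diff_distrib left_diff_distrib)
  show ?thesis
    by (induction a rule: frag_induction[OF subset_UNIV])
      (simp_all add: 2 commutator_linear coeff_map_0 coeff_map_diff right_diff_distrib left_diff_distrib)
qed

text \<open>
  The functional itself does not vanish on an ideal, but the elements that it kills together with
  all their multiples by monomials on both sides form one.
\<close>

lemma grassmann_T32:
  assumes "w \<in> T32"
  shows "coeff_map (grassmann I) (\<Psi> w) = 0"
proof -
  define K where "K = {F. \<forall>p q. coeff_map (grassmann I) (frag_of p * F * frag_of q) = 0}"
  have sub: "add_subgroup K"
    by (auto simp: add_subgroup_def K_def coeff_map_0 coeff_map_diff right_diff_distrib left_diff_distrib)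
  have "r * a \<in> K" if a: "a \<in> K" for a r
  proof (induction r rule: frag_induction[OF subset_UNIV])
    case (2 k)
    have "frag_of p * (frag_of k * a) * frag_of q = frag_of (p + k) * a * frag_of q" for p q
      by (simp add: frag_of_mult[symmetric] mult.assoc)
    then show ?case using a by (simp add: K_def del: split_paired_All)
  qed (use add_subgroupD[OF sub] in \<open>auto simp: left_diff_distrib\<close>)
  moreover have "a * r \<in> K" if a: "a \<in> K" for a r
  proof (induction r rule: frag_induction[OF subset_UNIV])
    case (2 k)
    have "frag_of p * (a * frag_of k) * frag_of q = frag_of p * a * frag_of (k + q)" for p q
      by (simp add: frag_of_mult[symmetric] mult.assoc)
    then show ?case using a by (simp add: K_def del: split_paired_All)
  qed (use add_subgroupD[OF sub] in \<open>auto simp: right_diff_distrib\<close>)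
  ultimately have K: "two_sided_ideal K" using sub by (simp add: two_sided_ideal_def)
  have K3: "\<langle>\<langle>a, b\<rangle>, c\<rangle> \<in> K" for a b c by (simp add: K_def grassmann_lie3)
  have "\<Psi> w \<in> K"
    by (rule \<Psi>_T32[OF K _ _ assms])
      (use K3 two_sided_idealD[OF K] add_subgroupD[OF sub] in \<open>auto\<close>)
  then have "coeff_map (grassmann I) (frag_of 0 * \<Psi> w * frag_of 0) = 0" unfolding K_def by blast
  then show ?thesis by simp
qed

section \<open>Leading coefficients in the central variables\<close>

text \<open>
  In the product of the factors \<open>t\<^sub>i + y\<^sub>i + y'\<^sub>i\<close>, choosing \<open>y\<^sub>i\<close> or \<open>y'\<^sub>i\<close> anywhere lowers the
  \<open>t\<close>-degree.
\<close>

lemma word_image_top: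
  "word_image l - frag_of (mset l, 0, 0) \<in> supported {k. size (fst k) < length l}"
proof (induction l)
  case Nil
  show ?case using add_subgroupD(1)[OF add_subgroup_supported] by (simp add: zero_prod_def[symmetric])
next
  case (Cons i l)
  let ?t = "frag_of ({#i#}, 0, 0) :: model"
  have e: "word_image (i # l) - frag_of (mset (i # l), 0, 0)
    = gen_image i * (word_image l - frag_of (mset l, 0, 0)) + (gen_image i - ?t) * frag_of (mset l, 0, 0)"
    by (simp add: algebra_simps frag_of_mult)
  have "?t + frag_of (0, Word [i], 0) + frag_of (0, 0, Word [i]) \<in> supported {k. size (fst k) \<le> 1}"
    by (intro add_subgroupD(4)[OF add_subgroup_supported]) simp_all
  then have 1: "gen_image i * (word_image l - frag_of (mset l, 0, 0)) \<in> supported {k. size (fst k) < length (i # l)}"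
    by (intro supported_mult[OF _ Cons.IH]) (auto simp: gen_image_def)
  have "(frag_of (0, Word [i], 0) + frag_of (0, 0, Word [i]) :: model) \<in> supported {k. size (fst k) = 0}"
    by (intro add_subgroupD(4)[OF add_subgroup_supported]) simp_all
  then have 2: "(gen_image i - ?t) * frag_of (mset l, 0, 0) \<in> supported {k. size (fst k) < length (i # l)}"
    by (intro supported_mult[of _ "{k. size (fst k) = 0}" _ "{(mset l, 0, 0)}"]) (auto simp: gen_image_def)
  show ?case unfolding e using 1 2 by (rule add_subgroupD(4)[OF add_subgroup_supported])
qed

lemma coeff_map_shift:
  assumes "F \<in> supported {k. fst k = 0}"
  shows "coeff_map \<mu> (frag_of (m, 0, 0) * F) = frag_cmul (poly_mapping.lookup (coeff_map \<mu> F) 0) (frag_of m)"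
  using assms
proof (induction rule: supported_induct)
  case (one k)
  then show ?case by (cases k) (simp add: frag_of_mult coeff_map_of)
qed (simp_all add: coeff_map_0 right_diff_distrib coeff_map_diff lookup_minus frag_cmul_diff_distrib)

text \<open>
  This reduces independence of all products of a word and an expression \<open>c\<close> to independence of the
  expressions \<open>c\<close>, because a sorted word is determined by its multiset of letters.
\<close>

lemma coeff_map_top:
  assumes c: "\<Psi> c \<in> supported {k. fst k = 0}" and len: "length l \<le> size m"
  shows "poly_mapping.lookup (coeff_map \<mu> (\<Psi> (mon l * c))) m = (if mset l = m then poly_mapping.lookup (coeff_map \<mu> (\<Psi> c)) 0 else 0)"
proof -
  let ?R = "(word_image l - frag_of (mset l, 0, 0)) * \<Psi> c"
  have "?R \<in> supported {k. size (fst k) < length l}"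
    by (rule supported_mult[OF word_image_top c]) auto
  then have "poly_mapping.lookup (coeff_map \<mu> ?R) m = 0"
  proof (induction rule: supported_induct)
    case (one k)
    then show ?case using len by (cases k) (auto simp: coeff_map_of)
  qed (simp_all add: coeff_map_0 coeff_map_diff lookup_minus)
  moreover have "\<Psi> (mon l * c) = ?R + frag_of (mset l, 0, 0) * \<Psi> c"
    by (simp add: \<Psi>_mult \<Psi>_mon algebra_simps)
  ultimately show ?thesis
    by (simp add: coeff_map_add lookup_add coeff_map_shift[OF c])
qed

section \<open>Normal commutator expressions and their detectors\<close>

fun comm_prod :: "nat list \<Rightarrow> free_alg" where
  "comm_prod (a # b # l) = \<langle>gen a, gen b\<rangle> * comm_prod l"
| "comm_prod l = 1"

text \<open>
  \<open>Comms\<close> lists the letters of a product of commutators, two for each factor.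
\<close>

datatype proper = Comms "nat list" | Triple nat nat nat

primrec proper_el :: "proper \<Rightarrow> free_alg" where
  "proper_el (Comms l) = comm_prod l"
| "proper_el (Triple i j k) = \<langle>\<langle>gen i, gen j\<rangle>, gen k\<rangle>"

primrec proper_degree :: "proper \<Rightarrow> nat" where
  "proper_degree (Comms l) = length l"
| "proper_degree (Triple i j k) = 3"

text \<open>
  The only exception to increasing letters is the length \<open>4\<close>: a product of two commutators is
  symmetric in its factors modulo \<open>T32\<close>, but not alternating in its four letters.
\<close>

primrec normal :: "proper \<Rightarrow> bool" where
  "normal (Comms l) \<longleftrightarrow> even (length l) \<and>
    (if length l = 4
     then l ! 0 < l ! 1 \<and> l ! 2 < l ! 3 \<and> (l ! 0 < l ! 2 \<or> l ! 0 = l ! 2 \<and> l ! 1 \<le> l ! 3)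
     else sorted_wrt (<) l)"
| "normal (Triple i j k) \<longleftrightarrow> j < i \<and> j \<le> k"

abbreviation y_word :: "nat list \<Rightarrow> model" where "y_word l \<equiv> frag_of (0, Word l, 0)"
abbreviation y'_word :: "nat list \<Rightarrow> model" where "y'_word l \<equiv> frag_of (0, 0, Word l)"

lemma \<Psi>_lie2:
  "\<Psi> \<langle>gen i, gen j\<rangle> = y_word [i, j] - y_word [j, i] + y'_word [i, j] - y'_word [j, i]"
  unfolding \<Psi>_commutator \<Psi>_mon
  by (simp add: gen_image_def commutator_def algebra_simps mult_single add_mset_commute)

lemma one_model: "(1::model) = y_word []"
  by (simp flip: zero_prod_def zero_fmon_def)

lemma \<Psi>_lie3:
  "\<Psi> \<langle>\<langle>gen i, gen j\<rangle>, gen k\<rangle> =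
    y_word [i, j, k] - y_word [j, i, k] - y_word [k, i, j] + y_word [k, j, i] +
    (y'_word [i, j, k] - y'_word [j, i, k] - y'_word [k, i, j] + y'_word [k, j, i])"
  unfolding \<Psi>_commutator[of "\<langle>_, _\<rangle>"] \<Psi>_lie2
  by (simp add: \<Psi>_mon gen_image_def commutator_def algebra_simps mult_single)

definition t_free :: "nat \<Rightarrow> (nat multiset \<times> nat fmon \<times> nat fmon) set" where
  "t_free d = {(m, v, v'). m = 0 \<and> wlen v + wlen v' = d}"

lemma \<Psi>_comm_prod_t_free: "even (length l) \<Longrightarrow> \<Psi> (comm_prod l) \<in> supported (t_free (length l))"
proof (induction l rule: comm_prod.induct)
  case (1 a b l)
  have "\<Psi> \<langle>gen a, gen b\<rangle> \<in> supported (t_free 2)"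
    unfolding \<Psi>_lie2 by (intro add_subgroupD[OF add_subgroup_supported]) (simp_all add: t_free_def)
  then have "\<Psi> \<langle>gen a, gen b\<rangle> * \<Psi> (comm_prod l) \<in> supported (t_free (length (a # b # l)))"
    by (rule supported_mult[of _ "t_free 2" _ "t_free (length l)"]) (use 1 in \<open>auto simp: t_free_def\<close>)
  then show ?case by (simp add: \<Psi>_mult)
next
  case "2_1"
  show ?case by (simp add: \<Psi>_1 one_model t_free_def del: single_one)
qed simp

lemma \<Psi>_proper_t_free: "normal c \<Longrightarrow> \<Psi> (proper_el c) \<in> supported (t_free (proper_degree c))"
proof (cases c)
  case (Triple i j k)
  show ?thesis unfolding Triple proper_el.simps \<Psi>_lie3
    by (intro add_subgroupD[OF add_subgroup_supported]) (simp_all add: t_free_def)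
qed (simp add: \<Psi>_comm_prod_t_free)

text \<open>
  A functional for each normal expression: in degrees up to \<open>4\<close> the coefficient of one of its
  monomials, in higher degrees the Grassmann functional. For a triple commutator \<open>[x\<^sub>i, x\<^sub>j, x\<^sub>k]\<close> the
  word \<open>jik\<close> is taken, since \<open>ijk\<close> also occurs in \<open>[x\<^sub>k, x\<^sub>j, x\<^sub>i]\<close>, which is normal too when \<open>j < k\<close>.
\<close>

primrec detector :: "proper \<Rightarrow> nat fmon \<Rightarrow> nat fmon \<Rightarrow> int" where
  "detector (Comms l) = (if length l \<le> 2 then indicator_at (Word l) 0
     else if length l = 4 then indicator_at (Word (take 2 l)) (Word (drop 2 l))
     else grassmann (set l))"
| "detector (Triple i j k) = indicator_at (Word [j, i, k]) 0"

lemma detector_T32: "w \<in> T32 \<Longrightarrow> coeff_map (detector c) (\<Psi> w) = 0"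
  by (cases c) (simp_all add: indicator_T32 grassmann_T32)

lemma detector_degree: "normal c \<Longrightarrow> detector c v v' \<noteq> 0 \<Longrightarrow> wlen v + wlen v' = proper_degree c"
proof (cases c)
  case (Comms l)
  assume c: "normal c" and t: "detector c v v' \<noteq> 0"
  show ?thesis
  proof (cases "length l \<le> 4")
    case True
    have "even (length l)" using c Comms by simp
    with True have "length l \<le> 2 \<or> length l = 4" by presburger
    then show ?thesis using t Comms by (auto simp: indicator_at_def split: if_splits)
  next
    case False
    then have "sorted_wrt (<) l" "distinct (letters v)" "set (letters v) = set l" "v' = 0"
      using c t Comms by (auto simp: grassmann_def signum_def split: if_splits)
    then show ?thesis using Comms
      by (metis add.right_neutral distinct_card letters_simps(1) list.size(3) proper_degree.simps(1) strict_sorted_iff)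
  qed
qed (auto simp: indicator_at_def split: if_splits)

text \<open>
  Under the Grassmann functional \<open>y\<^sub>a y\<^sub>b - y\<^sub>b y\<^sub>a\<close> acts as \<open>2 y\<^sub>a y\<^sub>b\<close>, and terms with a letter \<open>y'\<close> are
  dropped. The prefix \<open>u\<close> collects the letters already processed.
\<close>

lemma grassmann_comm_prod:
  "even (length l) \<Longrightarrow> coeff_map (grassmann I) (y_word u * \<Psi> (comm_prod l))
    = frag_cmul (2 ^ (length l div 2) * signum I (Word (u @ l))) (frag_of 0)"
proof (induction l arbitrary: u rule: comm_prod.induct)
  case (1 a b l)
  let ?F = "\<Psi> (comm_prod l)" and ?g = "coeff_map (grassmann I)"
  have z: "?g (y_word u * y'_word [c, d] * ?F) = 0" for c d
  proof (rule coeff_map_eq_0)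
    show "y_word u * y'_word [c, d] * ?F \<in> supported {(m, v, v'). v' \<noteq> 0}"
      by (rule supported_mult[of _ "{(0, Word u, Word [c, d])}" _ UNIV])
        (auto simp: frag_of_mult supported_def)
  qed (auto simp: grassmann_def)
  have s: "signum I (Word (u @ [b, a] @ l)) = - signum I (Word (u @ [a, b] @ l))"
    using signum_swap[of I "Word u" "Word [b]" "Word [a]" "Word l"] by simp
  have "y_word u * \<Psi> (comm_prod (a # b # l)) = y_word (u @ [a, b]) * ?F - y_word (u @ [b, a]) * ?F
    + y_word u * y'_word [a, b] * ?F - y_word u * y'_word [b, a] * ?F"
    by (simp add: \<Psi>_mult \<Psi>_lie2 algebra_simps mult_single flip: mult.assoc)
  moreover have "?g (y_word (u @ [a, b]) * ?F) = frag_cmul (2 ^ (length l div 2) * signum I (Word (u @ [a, b] @ l))) (frag_of 0)"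
    "?g (y_word (u @ [b, a]) * ?F) = frag_cmul (2 ^ (length l div 2) * - signum I (Word (u @ [a, b] @ l))) (frag_of 0)"
    using 1 s by simp_all
  ultimately show ?case
    by (simp only: coeff_map_add coeff_map_diff z)
      (simp add: frag_cmul_distrib[symmetric] frag_cmul_diff_distrib[symmetric] mult.assoc del: single_one)
next
  case "2_1"
  show ?case by (simp add: \<Psi>_1 coeff_map_of grassmann_def)
qed simp

text \<open>
  Of the four words of \<open>[x\<^sub>i, x\<^sub>j, x\<^sub>k]\<close>, the inequalities for normality allow only \<open>jik\<close> and, if
  \<open>j = k\<close>, also \<open>kij\<close> to equal \<open>j'i'k'\<close>. Both have the same sign, so nothing cancels.
\<close>

lemma detector_lie3:
  assumes "normal (Triple i j k)" "normal (Triple i' j' k')"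
  shows "poly_mapping.lookup (coeff_map (detector (Triple i' j' k')) (\<Psi> \<langle>\<langle>gen i, gen j\<rangle>, gen k\<rangle>)) 0 \<noteq> 0
    \<longleftrightarrow> i = i' \<and> j = j' \<and> k = k'"
proof -
  have v: "poly_mapping.lookup (coeff_map (detector (Triple i' j' k')) (\<Psi> \<langle>\<langle>gen i, gen j\<rangle>, gen k\<rangle>)) 0 =
    of_bool (i = j' \<and> j = i' \<and> k = k') - of_bool (j = j' \<and> i = i' \<and> k = k')
    - of_bool (k = j' \<and> i = i' \<and> j = k') + of_bool (k = j' \<and> j = i' \<and> i = k')"
    unfolding \<Psi>_lie3 detector.simps coeff_map_diff coeff_map_add coeff_map_of lookup_minus lookup_add
    by (simp add: indicator_at_def of_bool_def cong: if_cong)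
  have f: "(i = j' \<and> j = i' \<and> k = k') = False" "(k = j' \<and> j = i' \<and> i = k') = False"
    using assms by auto
  have g: "(of_bool False - of_bool P - of_bool Q + of_bool False \<noteq> (0::int)) \<longleftrightarrow> P" if "Q \<longrightarrow> P" for P Q
    using that by auto
  have c: "k = j' \<and> i = i' \<and> j = k' \<longrightarrow> j = j' \<and> i = i' \<and> k = k'"
    using assms by auto
  show ?thesis unfolding v f g[OF c] by blast
qed

text \<open>
  The part of \<open>\<Psi> ([x\<^sub>i, x\<^sub>j][x\<^sub>k, x\<^sub>m])\<close> with words of length two is the symmetrisation
  \<open>[y\<^sub>i, y\<^sub>j][y'\<^sub>k, y'\<^sub>m] + [y\<^sub>k, y\<^sub>m][y'\<^sub>i, y'\<^sub>j]\<close>. The normal order of the two factors singles out one of the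
  two summands, or both when the factors are equal.
\<close>

lemma detector_lie2_lie2:
  assumes "normal (Comms [i, j, k, m])" "normal (Comms [i', j', k', m'])"
  shows "poly_mapping.lookup (coeff_map (detector (Comms [i', j', k', m'])) (\<Psi> (comm_prod [i, j, k, m]))) 0 \<noteq> 0
    \<longleftrightarrow> [i, j, k, m] = [i', j', k', m']"
proof -
  define g h :: "nat \<Rightarrow> nat \<Rightarrow> int"
    where "g a b = of_bool (a = i' \<and> b = j')" and "h a b = of_bool (a = k' \<and> b = m')" for a b
  let ?v = "\<lambda>F. poly_mapping.lookup (coeff_map (indicator_at (Word [i', j']) (Word [k', m'])) F) 0"
  have p: "\<Psi> (comm_prod [i, j, k, m]) =
    (y_word [i, j] - y_word [j, i] + y'_word [i, j] - y'_word [j, i]) * (y_word [k, m] - y_word [m, k] + y'_word [k, m] - y'_word [m, k])"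
    by (simp add: \<Psi>_lie2 \<Psi>_mult)
  have add: "?v (a - b) = ?v a - ?v b" "?v (a + b) = ?v a + ?v b" for a b
    by (simp_all add: coeff_map_diff coeff_map_add lookup_minus lookup_add)
  have mono: "?v (y_word [a, b] * y_word [c, d]) = 0" "?v (y'_word [a, b] * y'_word [c, d]) = 0"
    "?v (y_word [a, b] * y'_word [c, d]) = g a b * h c d" "?v (y'_word [a, b] * y_word [c, d]) = g c d * h a b" for a b c d
    by (simp_all add: frag_of_mult coeff_map_of indicator_at_def g_def h_def)
  have v: "?v (\<Psi> (comm_prod [i, j, k, m])) = (g i j - g j i) * (h k m - h m k) + (g k m - g m k) * (h i j - h j i)"
    unfolding p left_diff_distrib right_diff_distrib distrib_left distrib_right add mono by simp
  have o: "i < j" "k < m" "i' < j'" "k' < m'" using assms by auto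
  \<comment> \<open>A decreasing pair never matches the increasing pairs of the detector.\<close>
  have z: "g j i = 0" "g m k = 0" "h m k = 0" "h j i = 0" using o by (auto simp: g_def h_def)
  have "(g i j * h k m + g k m * h i j \<noteq> 0) \<longleftrightarrow> (i = i' \<and> j = j' \<and> k = k' \<and> m = m') \<or> (k = i' \<and> m = j' \<and> i = k' \<and> j = m')"
    by (simp add: g_def h_def of_bool_def)
  also have "\<dots> \<longleftrightarrow> [i, j, k, m] = [i', j', k', m']" using assms by auto
  finally show ?thesis using v z by simp
qed

text \<open>
  Every \<open>\<Psi> (proper_el c)\<close> is homogeneous in the total length of its words, so only expressions of
  equal degree have to be compared.
\<close>

lemma detector_dual:
  assumes c: "normal c" and c': "normal c'"
  shows "poly_mapping.lookup (coeff_map (detector c') (\<Psi> (proper_el c))) 0 \<noteq> 0 \<longleftrightarrow> c = c'"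
proof (cases "proper_degree c = proper_degree c'")
  case False
  have "coeff_map (detector c') (\<Psi> (proper_el c)) = 0"
    using \<Psi>_proper_t_free[OF c]
    by (rule coeff_map_eq_0) (use False detector_degree[OF c'] in \<open>fastforce simp: t_free_def\<close>)
  with False show ?thesis by auto
next
  case deg: True
  consider (T) i j k i' j' k' where "c = Triple i j k" "c' = Triple i' j' k'"
    | (C) l l' where "c = Comms l" "c' = Comms l'" "length l = length l'"
    using c c' deg by (cases c; cases c') auto
  then show ?thesis
  proof cases
    case T
    then show ?thesis using detector_lie3 c c' by simp
  next
    case C
    have ev: "even (length l)" using c C by simp
    have "length l = 0 \<or> length l = 2 \<or> length l = 4 \<or> length l > 4" using ev by presburger
    then consider "length l = 0" | "length l = 2" | "length l = 4" | "length l > 4" by blast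
    then show ?thesis
    proof cases
      case 1
      then show ?thesis using C coeff_map_of[of _ 0 0 0]
        by (simp add: \<Psi>_1 indicator_at_def flip: zero_prod_def)
    next
      case 2
      then obtain i j i' j' where l: "l = [i, j]" "l' = [i', j']"
        using C(3) by (auto simp: length_Suc_conv numeral_2_eq_2)
      have "i < j" "i' < j'" using c c' C l by simp_all
      then show ?thesis unfolding C l
        by (auto simp: \<Psi>_lie2 coeff_map_diff coeff_map_add coeff_map_of lookup_minus lookup_add indicator_at_def)
    next
      case 3
      then obtain i j k m i' j' k' m' where l: "l = [i, j, k, m]" "l' = [i', j', k', m']"
        using C(3) by (auto simp: length_Suc_conv numeral_eq_Suc)
      show ?thesis using detector_lie2_lie2[of i j k m i' j' k' m'] c c'
        unfolding C l proper_el.simps proper.inject by blast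
    next
      case 4
      then have s: "sorted_wrt (<) l" "sorted_wrt (<) l'" using c c' C by (auto split: if_splits)
      have "coeff_map (detector c') (\<Psi> (proper_el c)) = frag_cmul (2 ^ (length l div 2) * signum (set l') (Word l)) (frag_of 0)"
        using grassmann_comm_prod[OF ev, of "set l'" "[]"] C 4 by (simp flip: one_model)
      then have "poly_mapping.lookup (coeff_map (detector c') (\<Psi> (proper_el c))) 0 = 2 ^ (length l div 2) * signum (set l') (Word l)"
        by simp
      moreover have "signum (set l') (Word l) \<noteq> 0 \<longleftrightarrow> set l = set l'"
        using s by (simp add: signum_def strict_sorted_iff)
      moreover have "set l = set l' \<longleftrightarrow> l = l'" using s strict_sorted_equal by blast
      ultimately show ?thesis using C by simp
    qed
  qed
qed

section \<open>Reducing commutator expressions to normal form\<close>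

inductive_set add_span :: "'a::ab_group_add set \<Rightarrow> 'a set" for B where
  zero: "0 \<in> add_span B"
| base: "b \<in> B \<Longrightarrow> b \<in> add_span B"
| diff: "a \<in> add_span B \<Longrightarrow> b \<in> add_span B \<Longrightarrow> a - b \<in> add_span B"

lemma add_subgroup_add_span: "add_subgroup (add_span B)"
  by (auto simp: add_subgroup_def intro: add_span.intros)

lemma add_span_image:
  assumes "a \<in> add_span B" "add_subgroup D" "\<And>b. b \<in> B \<Longrightarrow> r * b * s \<in> D"
  shows "(r * a * s :: 'a::ring_1) \<in> D"
  using assms(1)
  by (induction) (use assms(2,3) in \<open>auto simp: add_subgroup_def right_diff_distrib left_diff_distrib\<close>)

definition basis_index :: "(nat list \<times> proper) set" where
  "basis_index = {(l, c). sorted l \<and> normal c}"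

definition basis_el :: "nat list \<times> proper \<Rightarrow> free_alg" where
  "basis_el = (\<lambda>(l, c). mon l * proper_el c)"

definition spanned :: "free_alg set" where
  "spanned = add_span (basis_el ` basis_index \<union> T32)"

lemma add_subgroup_spanned: "add_subgroup spanned"
  by (simp add: spanned_def add_subgroup_add_span)

lemmas spannedD = add_subgroupD[OF add_subgroup_spanned]

lemma T32_spanned: "a \<in> T32 \<Longrightarrow> a \<in> spanned"
  by (simp add: spanned_def add_span.base)

lemma basis_spanned: "sorted l \<Longrightarrow> normal c \<Longrightarrow> mon l * proper_el c \<in> spanned"
  unfolding spanned_def by (rule add_span.base) (force simp: basis_index_def basis_el_def)

lemmas T32_sub = add_subgroupD[OF two_sided_idealD(1)[OF T32_two_sided]]
lemmas T32_mult = two_sided_idealD(2,3)[OF T32_two_sided]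

lemma T32_lie2_lie3: "\<langle>d, e\<rangle> * \<langle>\<langle>a, b\<rangle>, c\<rangle> \<in> T32"
proof -
  have "\<langle>d, e\<rangle> * \<langle>\<langle>a, b\<rangle>, c\<rangle> = \<langle>\<langle>a, b\<rangle>, c\<rangle> * \<langle>d, e\<rangle> - (\<langle>\<langle>\<langle>a, b\<rangle>, c\<rangle>, d * e\<rangle> - \<langle>\<langle>\<langle>a, b\<rangle>, c\<rangle>, e * d\<rangle>)"
    by (simp add: commutator_def algebra_simps)
  then show ?thesis using T32_lcomm32 T32_lcomm4 T32_sub(2) by metis
qed

lemma T32_lie2_commute: "\<langle>\<langle>a, b\<rangle>, \<langle>c, d\<rangle>\<rangle> \<in> T32"
proof -
  have "\<langle>\<langle>a, b\<rangle>, \<langle>c, d\<rangle>\<rangle> = \<langle>\<langle>\<langle>a, b\<rangle>, c\<rangle>, d\<rangle> - \<langle>\<langle>\<langle>a, b\<rangle>, d\<rangle>, c\<rangle>"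
    by (simp add: commutator_def algebra_simps)
  then show ?thesis using T32_lcomm4 T32_sub(2) by metis
qed

text \<open>
  The identity for triple commutators, applied to \<open>[a, ab, c]\<close>, produces a relation between products
  of commutators.
\<close>

lemma T32_square: "\<langle>a, c\<rangle> * \<langle>a, b\<rangle> * \<langle>e, f\<rangle> \<in> T32"
proof -
  have "\<langle>a, c\<rangle> * \<langle>a, b\<rangle> * \<langle>e, f\<rangle> = \<langle>\<langle>a, a * b\<rangle>, c\<rangle> * \<langle>e, f\<rangle> - a * (\<langle>\<langle>a, b\<rangle>, c\<rangle> * \<langle>e, f\<rangle>)"
    by (simp add: commutator_def algebra_simps)
  then show ?thesis using T32_lcomm32 T32_mult(1) T32_sub(2) by metis
qed

text \<open>
  The elements that vanish modulo \<open>T32\<close> once they meet one more commutator, on either side.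
\<close>

definition lie2_killed :: "free_alg \<Rightarrow> bool" where
  "lie2_killed u \<longleftrightarrow> (\<forall>e f. u * \<langle>e, f\<rangle> \<in> T32 \<and> \<langle>e, f\<rangle> * u \<in> T32)"

lemma lie2_killed_square: "lie2_killed (\<langle>c, a\<rangle> * \<langle>a, d\<rangle>)"
proof -
  have 1: "\<langle>c, a\<rangle> * \<langle>a, d\<rangle> * \<langle>e, f\<rangle> \<in> T32" for e f
  proof -
    have "\<langle>c, a\<rangle> * \<langle>a, d\<rangle> * \<langle>e, f\<rangle> = - (\<langle>a, c\<rangle> * \<langle>a, d\<rangle> * \<langle>e, f\<rangle>)"
      by (simp add: commutator_def algebra_simps)
    then show ?thesis using T32_square T32_sub(3) by metis
  qed
  moreover have "\<langle>e, f\<rangle> * (\<langle>c, a\<rangle> * \<langle>a, d\<rangle>) \<in> T32" for e f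
  proof -
    have "\<langle>e, f\<rangle> * (\<langle>c, a\<rangle> * \<langle>a, d\<rangle>) = \<langle>c, a\<rangle> * \<langle>a, d\<rangle> * \<langle>e, f\<rangle>
      + (\<langle>\<langle>e, f\<rangle>, \<langle>c, a\<rangle>\<rangle> * \<langle>a, d\<rangle> + \<langle>c, a\<rangle> * \<langle>\<langle>e, f\<rangle>, \<langle>a, d\<rangle>\<rangle>)"
      by (simp add: commutator_def algebra_simps)
    then show ?thesis using 1 T32_lie2_commute T32_mult T32_sub(4) by metis
  qed
  ultimately show ?thesis by (simp add: lie2_killed_def)
qed

text \<open>
  The polarisation of the preceding relation.
\<close>

lemma lie2_killed_swap: "lie2_killed (\<langle>c, a\<rangle> * \<langle>b, d\<rangle> + \<langle>c, b\<rangle> * \<langle>a, d\<rangle>)"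
proof -
  have "\<langle>c, a\<rangle> * \<langle>b, d\<rangle> + \<langle>c, b\<rangle> * \<langle>a, d\<rangle>
    = \<langle>c, a + b\<rangle> * \<langle>a + b, d\<rangle> - \<langle>c, a\<rangle> * \<langle>a, d\<rangle> - \<langle>c, b\<rangle> * \<langle>b, d\<rangle>"
    by (simp add: commutator_def algebra_simps)
  then show ?thesis
    using lie2_killed_square[of c "a + b" d] lie2_killed_square[of c a d] lie2_killed_square[of c b d]
    by (simp add: lie2_killed_def left_diff_distrib right_diff_distrib T32_sub(2))
qed

lemma comm_prod_append: "even (length u) \<Longrightarrow> comm_prod (u @ v) = comm_prod u * comm_prod v"
  by (induction u rule: comm_prod.induct) (simp_all add: mult.assoc)

lemma lie2_killed_context:
  assumes "lie2_killed k" "even (length u)" "even (length v)" "u \<noteq> [] \<or> v \<noteq> []"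
  shows "comm_prod u * k * comm_prod v \<in> T32"
proof (cases v rule: comm_prod.cases)
  case (1 a b w)
  have "comm_prod u * k * comm_prod v = comm_prod u * (k * \<langle>gen a, gen b\<rangle>) * comm_prod w"
    by (simp add: 1 mult.assoc)
  then show ?thesis using assms(1) T32_mult by (simp add: lie2_killed_def)
next
  case "2_1"
  then obtain a u' where u': "u = u' @ [a]" using assms(4) by (cases u rule: rev_cases) auto
  then obtain b u'' where u: "u = u'' @ [b, a]" using assms(2) by (cases u' rule: rev_cases) auto
  have "comm_prod u * k * comm_prod v = comm_prod u'' * (\<langle>gen b, gen a\<rangle> * k)"
    using assms(2) by (simp add: u "2_1" comm_prod_append mult.assoc)
  then show ?thesis using assms(1) T32_mult by (simp add: lie2_killed_def)
qed (use assms in simp)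

text \<open>
  If the two letters form one commutator, this is the antisymmetry of the bracket. If they belong to
  neighbouring commutators, the product contains \<open>[c, a][b, d]\<close>, and the bound on the length
  provides the third commutator that \<open>lie2_killed_swap\<close> asks for.
\<close>

lemma comm_prod_alternating:
  assumes "even (length (u @ a # b # v))" "length (u @ a # b # v) \<ge> 6"
  shows "comm_prod (u @ a # b # v) + comm_prod (u @ b # a # v) \<in> T32" (is ?S)
    and "a = b \<Longrightarrow> comm_prod (u @ a # b # v) \<in> T32" (is "_ \<Longrightarrow> ?E")
proof -
  have "?S \<and> (a = b \<longrightarrow> ?E)"
  proof (cases "even (length u)")
    case True
    have "\<langle>gen b, gen a\<rangle> = - \<langle>gen a, gen b\<rangle>" by (simp add: commutator_def)
    then have ?S using True T32_sub(1) by (simp add: comm_prod_append)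
    moreover have "\<langle>gen a, gen a\<rangle> = 0" by (simp add: commutator_def)
    then have "a = b \<longrightarrow> ?E" using True T32_sub(1) by (auto simp: comm_prod_append)
    ultimately show ?thesis by blast
  next
    case False
    then obtain c p where u: "u = p @ [c]" by (cases u rule: rev_cases) auto
    obtain d q where v: "v = d # q" using False assms(1) by (cases v) auto
    have ev: "even (length p)" "even (length q)" "p \<noteq> [] \<or> q \<noteq> []"
      using assms False by (auto simp: u v)
    have e: "comm_prod (u @ a # b # v) = comm_prod p * (\<langle>gen c, gen a\<rangle> * \<langle>gen b, gen d\<rangle>) * comm_prod q" for a b
      using ev by (simp add: u v comm_prod_append mult.assoc)
    have "comm_prod (u @ a # b # v) + comm_prod (u @ b # a # v) =
      comm_prod p * (\<langle>gen c, gen a\<rangle> * \<langle>gen b, gen d\<rangle> + \<langle>gen c, gen b\<rangle> * \<langle>gen a, gen d\<rangle>) * comm_prod q"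
      by (simp add: e algebra_simps)
    then show ?thesis
      using lie2_killed_context[OF lie2_killed_swap ev] lie2_killed_context[OF lie2_killed_square ev] e
      by auto
  qed
  then show ?S "a = b \<Longrightarrow> ?E" by auto
qed

lemma not_strict_sorted_adjacent:
  assumes "\<not> sorted_wrt (<) l"
  obtains u a b v where "l = u @ a # b # v" "b \<le> (a::nat)"
proof -
  obtain i where i: "Suc i < length l" "\<not> l ! i < l ! Suc i"
    using assms by (auto simp: sorted_wrt_iff_nth_Suc_transp)
  then have "l = take i l @ l ! i # l ! Suc i # drop (Suc (Suc i)) l"
    by (simp add: Cons_nth_drop_Suc)
  then show ?thesis using i(2) that by (meson leI)
qed

text \<open>
  Long products are sorted by exchanging adjacent letters, which lowers the number of inversions;
  two commutators are only oriented and ordered.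
\<close>

lemma comm_prod_spanned:
  assumes w: "sorted w"
  shows "even (length l) \<Longrightarrow> mon w * comm_prod l \<in> spanned"
proof (induction "inversions l" arbitrary: l rule: less_induct)
  case less
  have "length l = 0 \<or> length l = 2 \<or> length l = 4 \<or> length l \<ge> 6" using less.prems by presburger
  then consider "length l = 0" | "length l = 2" | "length l = 4" | "length l \<ge> 6" by blast
  then show ?case
  proof cases
    case 1
    then show ?thesis using basis_spanned[OF w, of "Comms []"] by simp
  next
    case 2
    then obtain i j where l: "l = [i, j]" by (auto simp: length_Suc_conv numeral_eq_Suc)
    consider "i < j" | "i = j" | "j < i" by linarith
    then show ?thesis
    proof cases
      case 1
      then show ?thesis using basis_spanned[OF w, of "Comms [i, j]"] by (simp add: l)
    next
      case 2
      then show ?thesis using spannedD(1) by (simp add: l commutator_def)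
    next
      case 3
      have "mon w * comm_prod l = - (mon w * proper_el (Comms [j, i]))"
        by (simp add: l commutator_def algebra_simps)
      then show ?thesis using spannedD(3)[OF basis_spanned[OF w, of "Comms [j, i]"]] 3 by simp
    qed
  next
    case 3
    then obtain i j k m where l: "l = [i, j, k, m]" by (auto simp: length_Suc_conv numeral_eq_Suc)
    have ordered: "mon w * (\<langle>gen i, gen j\<rangle> * \<langle>gen k, gen m\<rangle>) \<in> spanned" if "i < j" "k < m" for i j k m
    proof (cases "i < k \<or> i = k \<and> j \<le> m")
      case True
      then show ?thesis using basis_spanned[OF w, of "Comms [i, j, k, m]"] that by (simp add: mult.assoc)
    next
      case False
      have "mon w * (\<langle>gen i, gen j\<rangle> * \<langle>gen k, gen m\<rangle>) = mon w * proper_el (Comms [k, m, i, j])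
        + mon w * \<langle>\<langle>gen i, gen j\<rangle>, \<langle>gen k, gen m\<rangle>\<rangle>"
        by (simp add: commutator_def[of "\<langle>gen i, gen j\<rangle>"] algebra_simps)
      moreover have "mon w * proper_el (Comms [k, m, i, j]) \<in> spanned"
        using False that by (intro basis_spanned[OF w]) auto
      moreover have "mon w * \<langle>\<langle>gen i, gen j\<rangle>, \<langle>gen k, gen m\<rangle>\<rangle> \<in> spanned"
        by (intro T32_spanned T32_mult T32_lie2_commute)
      ultimately show ?thesis using spannedD(4) by metis
    qed
    have sw: "\<langle>gen b, gen a\<rangle> = - \<langle>gen a, gen b\<rangle>" for a b by (simp add: commutator_def)
    have half: "mon w * (\<langle>gen i, gen j\<rangle> * \<langle>gen k, gen m\<rangle>) \<in> spanned" if "i < j" for i j k m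
    proof (cases k m rule: linorder_cases)
      case equal
      then show ?thesis using spannedD(1) by (simp add: commutator_def)
    next
      case greater
      then show ?thesis using spannedD(3)[OF ordered[OF that greater]] by (simp add: sw[of m k])
    qed (rule ordered[OF that])
    have "mon w * (\<langle>gen i, gen j\<rangle> * \<langle>gen k, gen m\<rangle>) \<in> spanned"
    proof (cases i j rule: linorder_cases)
      case equal
      then show ?thesis using spannedD(1) by (simp add: commutator_def)
    next
      case greater
      then show ?thesis using spannedD(3)[OF half[OF greater, of k m]] by (simp add: sw[of j i])
    qed (rule half)
    then show ?thesis by (simp add: l)
  next
    case 4
    show ?thesis
    proof (cases "sorted_wrt (<) l")
      case True
      then show ?thesis using 4 less.prems basis_spanned[OF w, of "Comms l"] by simp
    next
      case False
      then obtain u a b v where l: "l = u @ a # b # v" "b \<le> a" by (rule not_strict_sorted_adjacent)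
      note alt = comm_prod_alternating[of u a b v, folded l(1), OF less.prems 4]
      show ?thesis
      proof (cases "a = b")
        case True
        then show ?thesis by (intro T32_spanned T32_mult alt)
      next
        case False
        have "inversions (u @ b # a # v) < inversions l"
          using False l(2) by (simp add: l(1) inversions_append cross_inversions_Cons)
        then have "mon w * comm_prod (u @ b # a # v) \<in> spanned"
          using less.prems by (intro less.hyps) (simp_all add: l(1))
        moreover have "mon w * (comm_prod l + comm_prod (u @ b # a # v)) \<in> spanned"
          by (intro T32_spanned T32_mult alt)
        ultimately show ?thesis using spannedD(2) by (fastforce simp: distrib_left)
      qed
    qed
  qed
qed

text \<open>
  The Jacobi identity rewrites \<open>[x\<^sub>i, x\<^sub>j, x\<^sub>k]\<close> with \<open>i > j > k\<close> in terms of the two triple commutators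
  with the smallest letter in second place.
\<close>

lemma lie3_spanned:
  assumes w: "sorted w"
  shows "mon w * \<langle>\<langle>gen i, gen j\<rangle>, gen k\<rangle> \<in> spanned"
proof -
  have desc: "mon w * \<langle>\<langle>gen i, gen j\<rangle>, gen k\<rangle> \<in> spanned" if "j < i" for i j k
  proof (cases "j \<le> k")
    case True
    then show ?thesis using basis_spanned[OF w, of "Triple i j k"] that by simp
  next
    case False
    have "mon w * \<langle>\<langle>gen i, gen j\<rangle>, gen k\<rangle> =
      mon w * proper_el (Triple i k j) - mon w * proper_el (Triple j k i)"
      by (simp add: commutator_def algebra_simps)
    moreover have "mon w * proper_el (Triple i k j) \<in> spanned" "mon w * proper_el (Triple j k i) \<in> spanned"
      using False that by (intro basis_spanned[OF w]; simp)+
    ultimately show ?thesis using spannedD(2) by metis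
  qed
  show ?thesis
  proof (cases i j rule: linorder_cases)
    case less
    have "mon w * \<langle>\<langle>gen i, gen j\<rangle>, gen k\<rangle> = - (mon w * \<langle>\<langle>gen j, gen i\<rangle>, gen k\<rangle>)"
      by (simp add: commutator_def algebra_simps)
    then show ?thesis using spannedD(3)[OF desc[OF less]] by simp
  next
    case equal
    then show ?thesis using spannedD(1) by (simp add: commutator_def)
  qed (rule desc)
qed

section \<open>Sorting the generators of a word\<close>

inductive_set short_commutators :: "free_alg set" where
  "\<langle>gen i, gen j\<rangle> \<in> short_commutators"
| "\<langle>\<langle>gen i, gen j\<rangle>, gen k\<rangle> \<in> short_commutators"

text \<open>
  The error terms that arise when a generator is moved through a word with letters in \<open>S\<close>. Keeping
  track of the letters ensures that the remaining words stay sorted when a smaller letter is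
  prepended.
\<close>

definition corrections :: "nat set \<Rightarrow> free_alg set" where
  "corrections S = add_span ({mon l * d | l d. sorted l \<and> set l \<subseteq> S \<and> d \<in> short_commutators} \<union> T32)"

lemma add_subgroup_corrections: "add_subgroup (corrections S)"
  by (simp add: corrections_def add_subgroup_add_span)

lemmas correctionsD = add_subgroupD[OF add_subgroup_corrections]

lemma corrections_base: "sorted l \<Longrightarrow> set l \<subseteq> S \<Longrightarrow> d \<in> short_commutators \<Longrightarrow> mon l * d \<in> corrections S"
  unfolding corrections_def by (rule add_span.base) blast

lemma corrections_T32: "a \<in> T32 \<Longrightarrow> a \<in> corrections S"
  unfolding corrections_def by (rule add_span.base) blast

text \<open>
  The factors \<open>r\<close> and \<open>s\<close> allow the map applied to the corrections to be a multiplication on either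
  side.
\<close>

lemma corrections_induct:
  assumes "v \<in> corrections S" "add_subgroup D"
    "\<And>l d. sorted l \<Longrightarrow> set l \<subseteq> S \<Longrightarrow> d \<in> short_commutators \<Longrightarrow> r * (mon l * d) * s \<in> D"
    "\<And>a. a \<in> T32 \<Longrightarrow> r * a * s \<in> D"
  shows "r * v * s \<in> D"
  using assms(1) unfolding corrections_def
  by (rule add_span_image) (use assms(2-) in auto)

lemma mon_Cons: "mon (a # l) = gen a * mon l"
  by (simp add: mult_single)

lemma corrections_mono:
  assumes "v \<in> corrections S" "S \<subseteq> S'"
  shows "v \<in> corrections S'"
proof -
  have "1 * v * 1 \<in> corrections S'"
    using assms(1) add_subgroup_corrections
    by (rule corrections_induct) (use assms(2) in \<open>auto intro: corrections_base corrections_T32\<close>)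
  then show ?thesis by simp
qed

lemma corrections_Cons:
  assumes "v \<in> corrections S" "\<forall>s\<in>S. a \<le> s"
  shows "gen a * v \<in> corrections (insert a S)"
proof -
  have "gen a * v * 1 \<in> corrections (insert a S)"
    using assms(1)
  proof (rule corrections_induct)
    fix l d assume "sorted l" "set l \<subseteq> S" "d \<in> short_commutators"
    then have "mon (a # l) * d \<in> corrections (insert a S)"
      using assms(2) by (intro corrections_base) auto
    then show "gen a * (mon l * d) * 1 \<in> corrections (insert a S)"
      unfolding mon_Cons[of a l] by (simp add: mult.assoc)
  qed (auto intro: add_subgroup_corrections corrections_T32 T32_mult)
  then show ?thesis by simp
qed

lemma lie2_mon_corrections: "sorted l \<Longrightarrow> \<langle>\<langle>gen i, gen j\<rangle>, mon l\<rangle> \<in> corrections (set l)"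
proof (induction l)
  case Nil
  show ?case using correctionsD(1) by (simp add: commutator_def flip: zero_fmon_def)
next
  case (Cons a l)
  let ?w = "\<langle>gen i, gen j\<rangle>"
  have "\<langle>?w, mon (a # l)\<rangle> = mon l * \<langle>?w, gen a\<rangle> + (\<langle>\<langle>?w, gen a\<rangle>, mon l\<rangle> + gen a * \<langle>?w, mon l\<rangle>)"
    unfolding mon_Cons[of a l] by (simp add: commutator_def algebra_simps)
  moreover have "mon l * \<langle>?w, gen a\<rangle> \<in> corrections (set (a # l))"
    using Cons.prems by (intro corrections_base short_commutators.intros) auto
  moreover have "\<langle>\<langle>?w, gen a\<rangle>, mon l\<rangle> \<in> corrections (set (a # l))"
    by (rule corrections_T32[OF T32_lcomm4])
  moreover have "gen a * \<langle>?w, mon l\<rangle> \<in> corrections (set (a # l))"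
    using Cons by (auto intro: corrections_Cons)
  ultimately show ?case using correctionsD(4) by metis
qed

lemma mon_gen_corrections: "sorted l \<Longrightarrow> \<langle>mon l, gen j\<rangle> \<in> corrections (set l)"
proof (induction l)
  case Nil
  show ?case using correctionsD(1) by (simp add: commutator_def flip: zero_fmon_def)
next
  case (Cons a l)
  let ?w = "\<langle>gen a, gen j\<rangle>"
  have "\<langle>mon (a # l), gen j\<rangle> = mon l * ?w + (\<langle>?w, mon l\<rangle> + gen a * \<langle>mon l, gen j\<rangle>)"
    unfolding mon_Cons[of a l] by (simp add: commutator_def algebra_simps)
  moreover have "mon l * ?w \<in> corrections (set (a # l))"
    using Cons.prems by (intro corrections_base short_commutators.intros) auto
  moreover have "\<langle>?w, mon l\<rangle> \<in> corrections (set (a # l))"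
    using Cons.prems by (auto intro: corrections_mono[OF lie2_mon_corrections])
  moreover have "gen a * \<langle>mon l, gen j\<rangle> \<in> corrections (set (a # l))"
    using Cons by (auto intro: corrections_Cons)
  ultimately show ?case using correctionsD(4) by metis
qed

text \<open>
  The new letter passes the larger letters at the end of the word. Each exchange leaves a
  commutator, which is moved to the right end at the cost of triple commutators; these are central
  modulo \<open>T32\<close>.
\<close>

lemma mon_times_gen: "sorted l \<Longrightarrow> mon l * gen j - mon (insort j l) \<in> corrections (set l)"
proof (induction l)
  case Nil
  show ?case using correctionsD(1) by (simp flip: zero_fmon_def)
next
  case (Cons a l)
  show ?case
  proof (cases "j \<le> a")
    case True
    have "mon (a # l) * gen j - mon (insort j (a # l)) = \<langle>mon (a # l), gen j\<rangle>"
      using True by (simp add: commutator_def mult_single)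
    then show ?thesis using mon_gen_corrections[OF Cons.prems] by metis
  next
    case False
    have "mon (a # l) * gen j - mon (insort j (a # l)) = gen a * (mon l * gen j - mon (insort j l))"
      using False by (simp add: mult_single right_diff_distrib)
    then show ?thesis using Cons corrections_Cons[of _ "set l" a] by auto
  qed
qed

text \<open>
  A commutator factor lengthens a product of commutators, and modulo \<open>T32\<close> a triple commutator
  annihilates commutators and triple commutators on either side.
\<close>

lemma corrections_proper_spanned:
  assumes "v \<in> corrections S" "normal c"
  shows "v * proper_el c \<in> spanned"
proof -
  have "1 * v * proper_el c \<in> spanned"
    using assms(1) add_subgroup_spanned
  proof (rule corrections_induct)
    fix l :: "nat list" and d assume l: "sorted l" and d: "d \<in> short_commutators"
    from d have "mon l * (d * proper_el c) \<in> spanned"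
    proof cases
      case (1 i j)
      show ?thesis
      proof (cases c)
        case (Comms k)
        then show ?thesis using comm_prod_spanned[OF l, of "i # j # k"] assms(2) by (simp add: 1)
      next
        case (Triple a b e)
        then show ?thesis using T32_spanned[OF T32_mult(1)[OF T32_lie2_lie3]] by (simp add: 1)
      qed
    next
      case (2 i j k)
      show ?thesis
      proof (cases c)
        case (Comms m)
        show ?thesis
        proof (cases m rule: comm_prod.cases)
          case (1 a b n)
          have "mon l * (d * proper_el c) = mon l * (d * \<langle>gen a, gen b\<rangle>) * comm_prod n"
            by (simp add: Comms 1 mult.assoc)
          then show ?thesis
            using T32_spanned[OF T32_mult(2)[OF T32_mult(1)[OF T32_lcomm32]]] by (simp add: 2)
        next
          case "2_1"
          then show ?thesis using lie3_spanned[OF l] by (simp add: 2 Comms)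
        qed (use assms(2) Comms in simp)
      next
        case (Triple a b e)
        then show ?thesis using T32_spanned[OF T32_mult(1)[OF T32_lcomm32]] by (simp add: 2)
      qed
    qed
    then show "1 * (mon l * d) * proper_el c \<in> spanned" by (simp add: mult.assoc)
  qed (auto intro!: T32_spanned T32_mult)
  then show ?thesis by simp
qed

lemma lie2_comm_prod_commutator:
  "even (length l) \<Longrightarrow> \<langle>a, b\<rangle> * \<langle>comm_prod l, x\<rangle> \<in> T32"
proof (induction l arbitrary: a b rule: comm_prod.induct)
  case (1 c d l)
  have "\<langle>a, b\<rangle> * \<langle>comm_prod (c # d # l), x\<rangle> =
    \<langle>a, b\<rangle> * \<langle>\<langle>gen c, gen d\<rangle>, x\<rangle> * comm_prod l + \<langle>a, b\<rangle> * (\<langle>gen c, gen d\<rangle> * \<langle>comm_prod l, x\<rangle>)"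
    by (simp add: commutator_def[of _ x] algebra_simps)
  moreover have "\<langle>a, b\<rangle> * \<langle>\<langle>gen c, gen d\<rangle>, x\<rangle> * comm_prod l \<in> T32"
    by (rule T32_mult(2)[OF T32_lie2_lie3])
  moreover have "\<langle>a, b\<rangle> * (\<langle>gen c, gen d\<rangle> * \<langle>comm_prod l, x\<rangle>) \<in> T32"
    by (rule T32_mult(1)[OF "1.IH"]) (use "1.prems" in simp)
  ultimately show ?case using T32_sub(4) by metis
qed (use T32_sub(1) in \<open>simp_all add: commutator_def\<close>)

text \<open>
  Only a single commutator fails to be central modulo \<open>T32\<close> among the expressions \<open>c\<close>, and it then
  yields a triple commutator.
\<close>

lemma mon_proper_commutator_spanned:
  assumes l: "sorted l" and c: "normal c"
  shows "mon l * \<langle>proper_el c, gen j\<rangle> \<in> spanned"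
proof (cases c)
  case (Triple a b e)
  then show ?thesis using T32_spanned[OF T32_mult(1)[OF T32_lcomm4]] by simp
next
  case (Comms k)
  show ?thesis
  proof (cases k rule: comm_prod.cases)
    case (1 a b n)
    have "mon l * \<langle>proper_el c, gen j\<rangle> = mon l * (\<langle>\<langle>gen a, gen b\<rangle>, gen j\<rangle> * comm_prod n)
      + mon l * (\<langle>gen a, gen b\<rangle> * \<langle>comm_prod n, gen j\<rangle>)"
      by (simp add: Comms 1 commutator_def[of _ "gen j"] algebra_simps)
    moreover have "mon l * (\<langle>gen a, gen b\<rangle> * \<langle>comm_prod n, gen j\<rangle>) \<in> spanned"
      using c Comms 1 by (intro T32_spanned T32_mult lie2_comm_prod_commutator) simp
    moreover have "mon l * (\<langle>\<langle>gen a, gen b\<rangle>, gen j\<rangle> * comm_prod n) \<in> spanned"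
    proof (cases n rule: comm_prod.cases)
      case (1 p q r)
      have "\<langle>\<langle>gen a, gen b\<rangle>, gen j\<rangle> * comm_prod n = \<langle>\<langle>gen a, gen b\<rangle>, gen j\<rangle> * \<langle>gen p, gen q\<rangle> * comm_prod r"
        by (simp add: 1 mult.assoc)
      then show ?thesis using T32_spanned[OF T32_mult(1)[OF T32_mult(2)[OF T32_lcomm32]]] by simp
    qed (use lie3_spanned[OF l] in simp_all)
    ultimately show ?thesis using spannedD(4) by metis
  qed (use Comms spannedD(1) in \<open>simp_all add: commutator_def\<close>)
qed

lemma spanned_times_gen:
  assumes "a \<in> spanned"
  shows "a * gen j \<in> spanned"
proof -
  have "1 * a * gen j \<in> spanned"
    using assms unfolding spanned_def
  proof (rule add_span_image, fold spanned_def)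
    fix b assume "b \<in> basis_el ` basis_index \<union> T32"
    then show "1 * b * gen j \<in> spanned"
    proof
      assume "b \<in> basis_el ` basis_index"
      then obtain l c where b: "b = mon l * proper_el c" and l: "sorted l" and c: "normal c"
        by (auto simp: basis_index_def basis_el_def)
      have "1 * b * gen j = (mon l * gen j - mon (insort j l)) * proper_el c
        + (mon (insort j l) * proper_el c + mon l * \<langle>proper_el c, gen j\<rangle>)"
        unfolding b commutator_def by (simp only: algebra_simps mult_1_left)
      moreover have "sorted (insort j l)" using l by (simp add: sorted_insort)
      ultimately show ?thesis
        using corrections_proper_spanned[OF mon_times_gen[OF l] c] basis_spanned c
          mon_proper_commutator_spanned[OF l c] spannedD(4) by metis
    qed (auto intro!: T32_spanned T32_mult)
  qed (rule add_subgroup_spanned)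
  then show ?thesis by simp
qed

lemma all_spanned: "a \<in> spanned"
proof (induction a rule: frag_induction[OF subset_UNIV])
  case (2 w)
  have "mon l \<in> spanned" for l
  proof (induction l rule: rev_induct)
    case Nil
    then show ?case using basis_spanned[of "[]" "Comms []"] by simp
  next
    case (snoc j l)
    then show ?case using spanned_times_gen[of "mon l" j] by (simp add: mult_single)
  qed
  then show ?case by (cases w) simp
qed (use spannedD in auto)


section \<open>The basis\<close>

lemma spanning:
  obtains f where "Poly_Mapping.keys f \<subseteq> basis_index" "w - frag_extend basis_el f \<in> T32"
proof -
  have "\<exists>f\<in>supported basis_index. w - frag_extend basis_el f \<in> T32"
    using all_spanned[of w] unfolding spanned_def
  proof induction
    case zero
    show ?case using T32_sub(1) add_subgroupD(1)[OF add_subgroup_supported] by (intro bexI[of _ 0]) auto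
  next
    case (base b)
    then show ?case
    proof
      assume "b \<in> basis_el ` basis_index"
      then obtain k where "k \<in> basis_index" "b = basis_el k" by blast
      then show ?thesis using T32_sub(1) by (intro bexI[of _ "frag_of k"]) auto
    next
      assume "b \<in> T32"
      then show ?thesis using add_subgroupD(1)[OF add_subgroup_supported] by (intro bexI[of _ 0]) auto
    qed
  next
    case (diff a b)
    then obtain f g where fg: "f \<in> supported basis_index" "g \<in> supported basis_index"
      "a - frag_extend basis_el f \<in> T32" "b - frag_extend basis_el g \<in> T32" by blast
    have "a - b - frag_extend basis_el (f - g) = (a - frag_extend basis_el f) - (b - frag_extend basis_el g)"
      by (simp add: frag_extend_diff)
    then have "a - b - frag_extend basis_el (f - g) \<in> T32" using fg T32_sub(2) by metis
    then show ?case using add_subgroupD(2)[OF add_subgroup_supported fg(1,2)] by blast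
  qed
  then show ?thesis using that by (auto simp: supported_def)
qed

text \<open>
  The restriction on the length of \<open>l\<close> is needed because \<open>\<Psi>\<close> of a longer word has terms of lower
  \<open>t\<close>-degree, too.
\<close>

lemma dual_functional:
  assumes i: "(l0, c0) \<in> basis_index" and i': "(l, c) \<in> basis_index" and len: "length l \<le> length l0"
  shows "poly_mapping.lookup (coeff_map (detector c0) (\<Psi> (basis_el (l, c)))) (mset l0) \<noteq> 0 \<longleftrightarrow> (l, c) = (l0, c0)"
proof -
  have s: "sorted l0" "normal c0" "sorted l" "normal c" using i i' by (auto simp: basis_index_def)
  have "\<Psi> (proper_el c) \<in> supported {k. fst k = 0}"
    by (rule supported_mono[OF _ \<Psi>_proper_t_free[OF s(4)]]) (auto simp: t_free_def)
  note top = coeff_map_top[OF this, of l "mset l0" "detector c0"]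
  have "mset l = mset l0 \<longleftrightarrow> l = l0" using s by (metis properties_for_sort sort_key_id_if_sorted sorted_sort_id)
  then show ?thesis using top len detector_dual[OF s(4,2)] by (simp add: basis_el_def)
qed

text \<open>
  In a relation, a basis element with a longest word is detected by its own functional alone.
\<close>

lemma independence:
  assumes f: "Poly_Mapping.keys f \<subseteq> basis_index" and T: "frag_extend basis_el f \<in> T32"
  shows "f = 0"
proof (rule ccontr)
  assume "f \<noteq> 0"
  then have "Poly_Mapping.keys f \<noteq> {}" by simp
  then have "Max ((\<lambda>k. length (fst k)) ` Poly_Mapping.keys f) \<in> (\<lambda>k. length (fst k)) ` Poly_Mapping.keys f"
    by (intro Max_in) simp_all
  then obtain k0 where k0: "k0 \<in> Poly_Mapping.keys f"
    and k0_Max: "Max ((\<lambda>k. length (fst k)) ` Poly_Mapping.keys f) = length (fst k0)" by blast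
  have max: "length (fst k) \<le> length (fst k0)" if "k \<in> Poly_Mapping.keys f" for k
    unfolding k0_Max[symmetric] using that by (intro Max_ge) simp_all
  obtain l0 c0 where k0_eq: "k0 = (l0, c0)" by (cases k0)
  define \<psi> where "\<psi> w = poly_mapping.lookup (coeff_map (detector c0) (\<Psi> w)) (mset l0)" for w
  have d: "\<psi> (a - b) = \<psi> a - \<psi> b" "\<psi> 0 = 0" for a b
    by (simp_all add: \<psi>_def \<Psi>_diff coeff_map_diff lookup_minus \<Psi>_0 coeff_map_0)
  have i0: "(l0, c0) \<in> basis_index" using f k0 k0_eq by auto
  have "f \<in> supported {k \<in> basis_index. length (fst k) \<le> length l0}"
    using f max by (auto simp: supported_def k0_eq)
  then have "\<psi> (frag_extend basis_el f) = poly_mapping.lookup f k0 * \<psi> (basis_el k0)"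
  proof (induction rule: supported_induct)
    case (one k)
    then show ?case using dual_functional[OF i0, of "fst k" "snd k"]
      by (auto simp: \<psi>_def k0_eq lookup_frag_of)
  qed (simp_all add: d frag_extend_diff lookup_minus left_diff_distrib)
  moreover have "\<psi> (frag_extend basis_el f) = 0" by (simp add: \<psi>_def detector_T32[OF T])
  moreover have "\<psi> (basis_el k0) \<noteq> 0" using dual_functional[OF i0 i0] by (simp add: \<psi>_def k0_eq)
  ultimately show False using k0 by (simp add: in_keys_iff)
qed

definition coset :: "free_alg \<Rightarrow> free_alg set" where
  "coset w = T32 +>\<^bsub>ZX\<^esub> w"

lemma coset_hom: "coset (a + b) = coset a \<oplus>\<^bsub>ZX Quot T32\<^esub> coset b"
  and coset_eq_iff: "coset a = coset b \<longleftrightarrow> a - b \<in> T32"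
  and carrier_Quot: "carrier (ZX Quot T32) = range coset"
proof -
  interpret ideal T32 ZX using T32_two_sided by (simp add: ideal_ZX_iff)
  show "carrier (ZX Quot T32) = range coset"
    by (auto simp: FactRing_def A_RCOSETS_def' coset_def ring_of_type_algebra_def)
  show "coset (a + b) = coset a \<oplus>\<^bsub>ZX Quot T32\<^esub> coset b"
    using ring_hom_add[OF rcos_ring_hom, of a b]
    by (simp add: coset_def ring_of_type_algebra_def)
  have co: "coset w = {t + w | t. t \<in> T32}" for w
    by (auto simp: coset_def a_r_coset_def r_coset_def ring_of_type_algebra_def)
  show "coset a = coset b \<longleftrightarrow> a - b \<in> T32"
  proof
    assume "coset a = coset b"
    then have "0 + a \<in> coset b" using T32_sub(1) co by blast
    then show "a - b \<in> T32" by (auto simp: co)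
  next
    assume ab: "a - b \<in> T32"
    have "t + a = (t + (a - b)) + b" "t + b = (t - (a - b)) + a" for t by simp_all
    then show "coset a = coset b" using ab T32_sub(2,4) unfolding co by blast
  qed
qed

theorem theorem1p3:
  shows "free_abelian (add_monoid (ZX Quot T32))"
proof -
  let ?G = "add_monoid (ZX Quot T32)"
  define h where "h f = coset (frag_extend basis_el f)" for f
  let ?F = "free_Abelian_group basis_index"
  have inj: "inj_on h (carrier ?F)"
  proof (rule inj_onI)
    fix f g assume fg: "f \<in> carrier ?F" "g \<in> carrier ?F" and "h f = h g"
    then have "frag_extend basis_el (f - g) \<in> T32" by (simp add: h_def coset_eq_iff frag_extend_diff)
    moreover have "Poly_Mapping.keys (f - g) \<subseteq> basis_index" using fg keys_diff[of f g] by auto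
    ultimately have "f - g = 0" by (intro independence)
    then show "f = g" by simp
  qed
  have "h ` carrier ?F = carrier ?G"
  proof
    show "h ` carrier ?F \<subseteq> carrier ?G" by (auto simp: h_def carrier_Quot)
    show "carrier ?G \<subseteq> h ` carrier ?F"
    proof
      fix c assume "c \<in> carrier ?G"
      then obtain w where w: "c = coset w" by (auto simp: carrier_Quot)
      obtain f where "Poly_Mapping.keys f \<subseteq> basis_index" "w - frag_extend basis_el f \<in> T32"
        by (rule spanning)
      then show "c \<in> h ` carrier ?F" by (auto simp: w h_def coset_eq_iff intro!: image_eqI[of _ _ f])
    qed
  qed
  then have "h \<in> iso ?F ?G"
    using inj by (auto simp: iso_def bij_betw_def hom_def h_def frag_extend_add coset_hom)
  then have "?F \<cong> ?G" by (rule is_isoI)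
  then have 1: "?G \<cong> ?F" using group.iso_sym[OF group_free_Abelian_group] by blast
  \<comment> \<open>A basis is wanted inside the element type of the group, so the index set is replaced by its image.\<close>
  have "inj_on (\<lambda>k. h (frag_of k)) basis_index"
    by (intro inj_onI) (auto dest!: inj_onD[OF inj] simp: frag_of_eq)
  then have "basis_index \<approx> (\<lambda>k. h (frag_of k)) ` basis_index"
    by (simp add: inj_on_image_eqpoll_self eqpoll_sym)
  then have 2: "?F \<cong> free_Abelian_group ((\<lambda>k. h (frag_of k)) ` basis_index)"
    by (simp add: isomorphic_free_Abelian_groups)
  show ?thesis unfolding free_abelian_def using iso_trans[OF 1 2] by blast
qed

end
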